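(* Let $q\ge1$ be an integer, let $a$ be an integer prime to $q$, and let $\widehat{G}_q$ be the group of Dirichlet characters modulo $q$. Let $P\ge2$ and $L\ge2$ be integers and let $s$ be a complex number with $\Re s>1$. Put $$Y_P(s;q,a|L)=-\sum_{\ell\le L}\frac1\ell\sum_{d\mid\ell}\mu(d)\sum_{\chi\in\widehat{G}_q}\frac{\overline{\chi}(a)}{\varphi(q)}\log L_P(\ell s,\chi^d).$$ Then there is a complex number $E$ with $|E|\le P^{-L\Re s}$ such that $$\prod_{\substack{p\ge P\\ p\equiv a\,[q]}}\left(1-\frac1{p^s}\right)=\exp\bigl(Y_P(s;q,a|L)+E\bigr).$$
   Context: The letter $p$ denotes primes; $p\equiv a\,[q]$ means $p\equiv a\pmod q$; $\varphi$ is Euler's function and $\mu$ the Möbius function; $\ell$ runs over positive integers. For a Dirichlet character $\chi$ modulo $q$ and $\Re s>1$, $$L_P(s,\chi)=\prod_{p\ge P}\left(1-\frac{\chi(p)}{p^s}\right)^{-1},$$ and its logarithm is $\log L_P(s,\chi)=\sum_{p\ge P}\sum_{k\ge1}\frac{\chi(p)^k}{k\,p^{ks}}$ (the branch tending to $0$ as $\Re s\to+\infty$). The character $\chi^d$ is the $d$-th power of $\chi$ in $\widehat{G}_q$ (a character modulo $q$). *)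

theory Defs
  imports "HOL-Analysis.Analysis" "HOL-Number_Theory.Number_Theory"
    "HOL-Computational_Algebra.Squarefree"
begin

unbundle no vec_syntax  (* frees the letter chi as a variable name *)

definition dirichlet_characters :: "nat \<Rightarrow> (int \<Rightarrow> complex) set" where
  "dirichlet_characters q = {\<chi>.
     (\<forall>m n. \<chi> (m * n) = \<chi> m * \<chi> n) \<and>
     (\<forall>m n. [m = n] (mod int q) \<longrightarrow> \<chi> m = \<chi> n) \<and>
     (\<forall>n. \<chi> n \<noteq> 0 \<longleftrightarrow> coprime n (int q))}"

definition character_group :: "nat \<Rightarrow> (int \<Rightarrow> complex) monoid" where
  "character_group q =
     \<lparr>carrier = dirichlet_characters q,
      monoid.mult = (\<lambda>\<chi> \<psi> n. \<chi> n * \<psi> n),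
      one = (\<lambda>n. if coprime n (int q) then 1 else 0)\<rparr>"

definition moebius_mu :: "nat \<Rightarrow> int" where
  "moebius_mu n = (if squarefree n then (- 1) ^ card (prime_factors n) else 0)"

definition L_from :: "nat \<Rightarrow> complex \<Rightarrow> (int \<Rightarrow> complex) \<Rightarrow> complex" where
  "L_from P s \<chi> =
     (\<Prod>p. if prime p \<and> p \<ge> P then inverse (1 - \<chi> (int p) / of_nat p powr s) else 1)"

text \<open>
  The branch of the logarithm of \<^term>\<open>L_from P s \<chi>\<close> is fixed by its series expansion,
  which converges absolutely for \<open>Re s > 1\<close>; see \<open>exp_log_L_from\<close> below.
\<close>

definition log_L_from :: "nat \<Rightarrow> complex \<Rightarrow> (int \<Rightarrow> complex) \<Rightarrow> complex" where
  "log_L_from P s \<chi> =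
     (\<Sum>\<^sub>\<infinity>p\<in>{p. prime p \<and> p \<ge> P}. \<Sum>\<^sub>\<infinity>k\<in>{1::nat..}.
        \<chi> (int p) ^ k / (of_nat k * of_nat p powr (of_nat k * s)))"

definition Y_P :: "nat \<Rightarrow> complex \<Rightarrow> nat \<Rightarrow> int \<Rightarrow> nat \<Rightarrow> complex" where
  "Y_P P s q a L =
     - (\<Sum>l = 1..L. 1 / of_nat l *
          (\<Sum>d | d dvd l. of_int (moebius_mu d) *
             (\<Sum>\<chi>\<in>carrier (character_group q).
                cnj (\<chi> a) / of_nat (totient q) *
                log_L_from P (of_nat l * s) (\<chi> [^]\<^bsub>character_group q\<^esub> d))))"

lemma comm_group_character_group: "comm_group (character_group q)"
proof (rule comm_groupI)
  fix \<chi> assume \<chi>: "\<chi> \<in> carrier (character_group q)"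
  have "(\<lambda>n. inverse (\<chi> n)) \<in> carrier (character_group q)"
    using \<chi> by (auto simp: character_group_def dirichlet_characters_def)
  moreover have "(\<lambda>n. inverse (\<chi> n)) \<otimes>\<^bsub>character_group q\<^esub> \<chi> = \<one>\<^bsub>character_group q\<^esub>"
    using \<chi> by (auto simp: character_group_def dirichlet_characters_def fun_eq_iff)
  ultimately show "\<exists>\<psi>\<in>carrier (character_group q).
      \<psi> \<otimes>\<^bsub>character_group q\<^esub> \<chi> = \<one>\<^bsub>character_group q\<^esub>" by blast
next
  show "\<one>\<^bsub>character_group q\<^esub> \<in> carrier (character_group q)"
    by (auto simp: character_group_def dirichlet_characters_def cong_imp_coprime
             dest: cong_imp_coprime cong_sym)
qed (auto simp: character_group_def dirichlet_characters_def fun_eq_iff mult_ac)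

lemma character_pow_totient:
  assumes "\<chi> \<in> dirichlet_characters q" "q \<ge> 1" "coprime n (int q)"
  shows "\<chi> n ^ totient q = 1"
proof -
  have mult: "\<chi> (x * y) = \<chi> x * \<chi> y" and per: "[x = y] (mod int q) \<Longrightarrow> \<chi> x = \<chi> y"
    and nz: "\<chi> x \<noteq> 0 \<longleftrightarrow> coprime x (int q)" for x y
    using assms(1) by (auto simp: dirichlet_characters_def)
  have 1: "\<chi> 1 = 1" using mult[of 1 1] nz[of 1] by simp
  have pow: "\<chi> (x ^ k) = \<chi> x ^ k" for x k by (induction k) (auto simp: 1 mult)
  define m where "m = nat (n mod int q)"
  have m: "int m = n mod int q" using assms(2) by (simp add: m_def)
  have cm: "[int m = n] (mod int q)" by (simp add: m cong_def)
  hence "coprime (int m) (int q)" using assms(3) cong_imp_coprime cong_sym by blast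
  hence "coprime m q" by simp
  hence "[m ^ totient q = 1] (mod q)" by (rule euler_theorem)
  hence "[int m ^ totient q = 1] (mod int q)"
    by (metis cong_int_iff of_nat_1 of_nat_power)
  hence "\<chi> (int m ^ totient q) = 1" using per 1 by metis
  thus ?thesis using pow per[OF cm] by simp
qed

lemma norm_character_le_1:
  assumes "\<chi> \<in> dirichlet_characters q" "q \<ge> 1"
  shows "norm (\<chi> n) \<le> 1"
proof (cases "coprime n (int q)")
  case True
  have "norm (\<chi> n) ^ totient q = 1"
    using character_pow_totient[OF assms True] by (metis norm_one norm_power)
  moreover have "totient q > 0" using assms(2) by simp
  ultimately show ?thesis
    using one_less_power[of "norm (\<chi> n)" "totient q"] by (smt (verit))
next
  case False
  hence "\<chi> n = 0" using assms(1) by (auto simp: dirichlet_characters_def)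
  thus ?thesis by simp
qed

lemma finite_dirichlet_characters:
  assumes "q \<ge> 1"
  shows "finite (dirichlet_characters q)"
proof (rule inj_on_finite)
  let ?R = "insert 0 {z::complex. z ^ totient q = 1}"
  let ?f = "\<lambda>\<chi>. restrict \<chi> {0..<int q}"
  show "inj_on ?f (dirichlet_characters q)"
  proof (rule inj_onI)
    fix \<chi> \<psi> assume *: "\<chi> \<in> dirichlet_characters q" "\<psi> \<in> dirichlet_characters q" "?f \<chi> = ?f \<psi>"
    show "\<chi> = \<psi>"
    proof
      fix n
      have mem: "n mod int q \<in> {0..<int q}" using assms by simp
      have "[n = n mod int q] (mod int q)" by (simp add: cong_def)
      hence "\<chi> n = \<chi> (n mod int q)" "\<psi> n = \<psi> (n mod int q)"
        using *(1,2) unfolding dirichlet_characters_def by blast+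
      thus "\<chi> n = \<psi> n" using fun_cong[OF *(3), of "n mod int q"] mem by simp
    qed
  qed
  show "?f ` dirichlet_characters q \<subseteq> PiE {0..<int q} (\<lambda>_. ?R)"
  proof
    fix f assume "f \<in> ?f ` dirichlet_characters q"
    then obtain \<chi> where \<chi>: "\<chi> \<in> dirichlet_characters q" and f: "f = ?f \<chi>" by blast
    have "\<chi> n \<in> ?R" for n
      using character_pow_totient[OF \<chi> assms, of n] \<chi>
      by (cases "coprime n (int q)") (auto simp: dirichlet_characters_def)
    thus "f \<in> PiE {0..<int q} (\<lambda>_. ?R)" by (auto simp: f)
  qed
  show "finite (PiE {0..<int q} (\<lambda>_. ?R))"
    using assms by (intro finite_PiE) (auto intro!: finite_roots_unity simp: Suc_le_eq)
qed

lemma log_L_from_has_prod: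
  assumes "\<chi> \<in> dirichlet_characters q" "q \<ge> 1" "Re s > 1"
  shows "(\<lambda>p. if prime p \<and> p \<ge> P then inverse (1 - \<chi> (int p) / of_nat p powr s) else 1)
           has_prod exp (log_L_from P s \<chi>)"
proof -
  define z where "z p = \<chi> (int p) / of_nat p powr s" for p :: nat
  define A where "A = {p::nat. prime p \<and> p \<ge> P}"
  have nz: "norm (z p) \<le> real p powr (- Re s)" if "p > 0" for p
  proof -
    have "norm (z p) = norm (\<chi> (int p)) * real p powr (- Re s)"
      using that by (simp add: z_def norm_divide norm_powr_real_powr powr_minus_divide)
    also have "\<dots> \<le> 1 * real p powr (- Re s)"
      by (intro mult_right_mono norm_character_le_1[OF assms(1,2)]) auto
    finally show ?thesis by simp
  qed
  have half: "norm (z p) < 1 / 2" if "prime p" for p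
  proof -
    have p: "p \<ge> 2" using that by (rule prime_ge_2_nat)
    have "norm (z p) \<le> real p powr (- Re s)" using nz p by simp
    also have "\<dots> \<le> 2 powr (- Re s)" using p assms(3) by (intro powr_mono2') auto
    also have "\<dots> < 2 powr (- 1)" using assms(3) by (intro powr_less_mono) auto
    finally show ?thesis by (simp add: powr_minus_divide)
  qed
  have inner: "(\<Sum>\<^sub>\<infinity>k\<in>{1::nat..}. \<chi> (int p) ^ k / (of_nat k * of_nat p powr (of_nat k * s)))
                 = - Ln (1 - z p)" if "prime p" for p
  proof -
    have p0: "of_nat p \<noteq> (0::complex)" using that by (metis of_nat_eq_0_iff not_prime_0)
    have lt: "norm (z p) < 1" using half[OF that] by simp
    have "(\<lambda>n. - ((- (- z p)) ^ n) / of_nat n) sums Ln (1 + (- z p))"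
      by (rule Ln_series') (use lt in simp)
    hence "(\<lambda>n. - (- (z p ^ n / of_nat n))) sums - Ln (1 - z p)"
      using sums_minus by fastforce
    hence S: "(\<lambda>n. z p ^ n / of_nat n) sums - Ln (1 - z p)" by simp
    have "summable (\<lambda>n. norm (z p ^ n / of_nat n))"
    proof (rule summable_comparison_test')
      show "summable (\<lambda>n. norm (z p) ^ n)" using lt by (intro summable_geometric) auto
      show "norm (norm (z p ^ n / of_nat n)) \<le> norm (z p) ^ n" if "n \<ge> 0" for n
        using mult_right_mono[of 1 "real n" "norm (z p) ^ n"]
        by (cases "n = 0") (auto simp: norm_divide norm_power divide_le_eq mult.commute)
    qed
    from norm_summable_imp_has_sum[OF this S]
    have "((\<lambda>n. z p ^ n / of_nat n) has_sum - Ln (1 - z p)) UNIV" .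
    also have "?this \<longleftrightarrow> ((\<lambda>k. \<chi> (int p) ^ k / (of_nat k * of_nat p powr (of_nat k * s)))
                 has_sum - Ln (1 - z p)) {1::nat..}"
    proof (rule has_sum_cong_neutral)
      fix k :: nat
      have "of_nat p powr (of_nat k * s) = (of_nat p powr s) ^ k"
        using p0 by (simp add: powr_def exp_of_nat_mult[symmetric] mult_ac)
      thus "z p ^ k / of_nat k = \<chi> (int p) ^ k / (of_nat k * of_nat p powr (of_nat k * s))"
        by (simp add: z_def power_divide mult_ac)
    qed (auto simp: not_le)
    finally show ?thesis by (rule infsumI)
  qed
  define g where "g p = (if p \<in> A then - Ln (1 - z p) else 0)" for p
  have abs: "summable (\<lambda>p. norm (g p))"
  proof (rule summable_comparison_test')
    show "summable (\<lambda>p. 2 * real p powr (- Re s))"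
      using assms(3) by (intro summable_mult) (simp add: summable_real_powr_iff)
    show "norm (norm (g p)) \<le> 2 * real p powr (- Re s)" for p
    proof (cases "p \<in> A")
      case True
      hence pr: "prime p" by (simp add: A_def)
      have "norm (Ln (1 + (- z p))) \<le> 2 * norm (- z p)"
        by (rule norm_Ln_le) (use half[OF pr] in simp)
      also have "\<dots> \<le> 2 * real p powr (- Re s)"
        using nz[of p] pr prime_gt_0_nat by simp
      finally show ?thesis using True by (simp add: g_def)
    qed (simp add: g_def)
  qed
  hence "(g has_sum suminf g) UNIV"
    by (rule norm_summable_imp_has_sum[OF _ summable_sums[OF summable_norm_cancel[OF abs]]])
  also have "?this \<longleftrightarrow> ((\<lambda>p. - Ln (1 - z p)) has_sum suminf g) A"
    by (rule has_sum_cong_neutral) (auto simp: g_def)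
  finally have "(\<Sum>\<^sub>\<infinity>p\<in>A. - Ln (1 - z p)) = suminf g" by (rule infsumI)
  moreover have "log_L_from P s \<chi> = (\<Sum>\<^sub>\<infinity>p\<in>A. - Ln (1 - z p))"
    unfolding log_L_from_def A_def[symmetric] by (rule infsum_cong, rule inner) (simp add: A_def)
  ultimately have "g sums log_L_from P s \<chi>"
    using summable_sums[OF summable_norm_cancel[OF abs]] by simp
  hence "(\<lambda>p. exp (g p)) has_prod exp (log_L_from P s \<chi>)"
    using sums_imp_has_prod_exp[of g] by (simp add: has_prod_def)
  moreover have "exp (g p) = (if prime p \<and> p \<ge> P then inverse (1 - z p) else 1)" for p
  proof (cases "p \<in> A")
    case True
    hence "norm (z p) < 1" using half[of p] by (simp add: A_def)
    hence "1 - z p \<noteq> 0" by auto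
    thus ?thesis using True by (simp add: g_def A_def exp_minus)
  qed (auto simp: g_def A_def)
  ultimately show ?thesis by (simp only: z_def)
qed

lemma exp_log_L_from:
  assumes "\<chi> \<in> dirichlet_characters q" "q \<ge> 1" "Re s > 1"
  shows "exp (log_L_from P s \<chi>) = L_from P s \<chi>"
  unfolding L_from_def by (rule has_prod_unique[OF log_L_from_has_prod[OF assms]])

end

theory Submission
  imports Defs "HOL-Real_Asymp.Real_Asymp"
begin

text \<open>
  Expand every logarithm into its prime power series. For fixed \<open>l\<close>, \<open>d\<close> and \<open>k\<close>, orthogonality of the
  characters (\<open>character_orthogonality\<close>) turns the average over \<open>\<chi>\<close> into the indicator \<open>b (d * k)\<close> of the
  congruence \<open>p ^ (d * k) \<equiv> a\<close> modulo \<open>q\<close>. Hence, with \<open>x = 1 / p powr s\<close>, \<open>Y_P\<close> is minus the sum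
  over the primes \<open>p \<ge> P\<close> of
  \<open>\<Sum>l\<le>L. \<Sum>k. x ^ (l * k) / (l * k) * (\<Sum>d | d dvd l. moebius_mu d * b (d * k))\<close>.
  If \<open>l\<close> runs over all positive integers, grouping by \<open>m = l * k\<close> makes the coefficient of \<open>x ^ m / m\<close> the
  Moebius convolution of \<open>b\<close>, which is \<open>b 1\<close> (\<open>sum_moebius_mu_convolution\<close>). The complete sum is therefore
  \<open>- Ln (1 - x)\<close> if \<open>p \<equiv> a\<close> and \<open>0\<close> otherwise (\<open>moebius_log_series\<close>), so that without truncation the
  exponential is exactly the product, and \<open>E\<close> is minus the sum over \<open>p\<close> of the tails \<open>l > L\<close>.

  The bound on \<open>E\<close> has constant \<open>1\<close>, and estimating the inner sum trivially by \<open>l\<close> would give \<open>12 / 7\<close>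
  below instead of \<open>6 / 7\<close>. But \<open>b\<close> takes only the values \<open>0\<close> and \<open>1\<close>, and the sum of \<open>moebius_mu d\<close> over
  the divisors of \<open>l \<ge> 2\<close> vanishes, so subtracting \<open>1 / 2\<close> from \<open>b\<close> gains a factor \<open>2\<close>
  (\<open>norm_sum_moebius_mu_le\<close>). The tail at \<open>p\<close> is then at most \<open>(4 / 7) r ^ (L + 1) / (1 - r)\<close> with
  \<open>r = norm x \<le> 1 / p\<close>, and these bounds are dominated by a telescoping sum over all integers \<open>p \<ge> P\<close>
  with total at most \<open>(6 / 7) P powr (- L Re s)\<close> (\<open>truncation_error_le_telescoping\<close>).

  Orthogonality rests on the existence of a character with \<open>\<chi> g \<noteq> 1\<close> for every unit \<open>g\<close> other than \<open>1\<close>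
  modulo \<open>q\<close>. It comes from decomposing functions on the group of units into simultaneous eigenfunctions
  of all translations, whose eigenvalues are the values of a character (\<open>ex_character_neq_1\<close>).
\<close>

section \<open>Orthogonality of Dirichlet characters\<close>

lemma sum_powers_roots_of_unity:
  assumes "i < N"
  shows "(\<Sum>z | z ^ N = (1::complex). z ^ i) = (if i = 0 then of_nat N else 0)"
proof (cases "i = 0")
  case True
  thus ?thesis using assms card_roots_unity_eq[of N] by simp
next
  case False
  have N: "N > 0" using assms by simp
  define w where "w = cis (2 * pi * real i / real N)"
  have "w \<noteq> 1"
  proof
    assume "w = 1"
    hence "cis (2 * pi * real i / real N) = cis (2 * pi * real 0 / real N)" by (simp add: w_def)
    hence "i = 0"
      using bij_betw_imp_inj_on[OF Complex.bij_betw_roots_unity[OF N]] assms N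
      unfolding inj_on_def by (metis lessThan_iff)
    thus False using False by simp
  qed
  have wN: "w ^ N = 1"
    using bij_betwE[OF Complex.bij_betw_roots_unity[OF N]] assms by (simp add: w_def)
  have "(\<Sum>z | z ^ N = (1::complex). z ^ i) = (\<Sum>j<N. cis (2 * pi * real j / real N) ^ i)"
    by (rule sum.reindex_bij_betw[OF Complex.bij_betw_roots_unity[OF N], symmetric])
  also have "\<dots> = (\<Sum>j<N. w ^ j)"
    unfolding w_def by (simp only: Complex.DeMoivre) (simp add: mult_ac)
  also have "\<dots> = 0"
    using \<open>w \<noteq> 1\<close> wN by (simp add: sum_gp_strict)
  finally show ?thesis using False by simp
qed

text \<open>
  Functions on the group of units modulo \<open>q\<close>, extended by zero to all integers: the regular
  representation of that group, on which the unit \<open>g\<close> acts by \<open>f \<mapsto> (\<lambda>x. f (g * x))\<close>.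
\<close>

definition unit_function :: "nat \<Rightarrow> (int \<Rightarrow> complex) \<Rightarrow> bool" where
  "unit_function q f \<longleftrightarrow>
     (\<forall>m n. [m = n] (mod int q) \<longrightarrow> f m = f n) \<and> (\<forall>n. \<not> coprime n (int q) \<longrightarrow> f n = 0)"

text \<open>
  Up to the factor \<open>totient q\<close>, the projection onto the eigenspace of the action of \<open>g\<close> with
  eigenvalue \<open>inverse z\<close>, for \<open>z\<close> a root of unity of order dividing \<open>totient q\<close>.
\<close>

definition eigen_projection :: "nat \<Rightarrow> int \<Rightarrow> complex \<Rightarrow> (int \<Rightarrow> complex) \<Rightarrow> int \<Rightarrow> complex" where
  "eigen_projection q g z f x = (\<Sum>i<totient q. z ^ i * f (g ^ i * x))"

lemma cong_power_totient:
  assumes "coprime g (int q)"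
  shows "[g ^ totient q = 1] (mod int q)"
proof (cases "q = 0")
  case False
  define m where "m = nat (g mod int q)"
  have "[int m = g] (mod int q)" using False by (simp add: m_def)
  moreover from this have "coprime m q"
    using assms by (metis cong_imp_coprime cong_sym coprime_int_iff)
  hence "[int m ^ totient q = 1] (mod int q)"
    using euler_theorem[of m q] by (metis cong_int_iff of_nat_1 of_nat_power)
  ultimately show ?thesis by (metis cong_pow cong_sym cong_trans)
qed simp

lemma unit_function_eigen_projection:
  assumes "unit_function q f"
  shows "unit_function q (eigen_projection q g z f)"
  unfolding unit_function_def
proof (intro conjI allI impI)
  fix m n assume "[m = n] (mod int q)"
  hence "[g ^ i * m = g ^ i * n] (mod int q)" for i by (intro cong_scalar_left)
  hence "f (g ^ i * m) = f (g ^ i * n)" for i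
    using assms unfolding unit_function_def by blast
  thus "eigen_projection q g z f m = eigen_projection q g z f n"
    by (simp add: eigen_projection_def)
next
  fix n assume "\<not> coprime n (int q)"
  hence "\<not> coprime (g ^ i * n) (int q)" for i by simp
  hence "f (g ^ i * n) = 0" for i
    using assms unfolding unit_function_def by blast
  thus "eigen_projection q g z f n = 0"
    by (simp add: eigen_projection_def)
qed

text \<open>
  Translation by \<open>g\<close> shifts the index \<open>i\<close> by one, and by Euler's theorem the sum is cyclic: the
  term that would have index \<open>totient q\<close> is the term of index \<open>0\<close>.
\<close>

lemma eigen_projection_shift:
  assumes "unit_function q f" "coprime g (int q)" "z ^ totient q = 1"
  shows "z * eigen_projection q g z f (g * x) = eigen_projection q g z f x"
proof -
  define h where "h i = z ^ i * f (g ^ i * x)" for i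
  have "[g ^ totient q * x = 1 * x] (mod int q)"
    by (intro cong_scalar_right cong_power_totient assms)
  hence "f (g ^ totient q * x) = f (1 * x)"
    using assms(1) unfolding unit_function_def by blast
  hence "h (totient q) = h 0" using assms(3) by (simp add: h_def)
  have "z * eigen_projection q g z f (g * x) = (\<Sum>i<totient q. h (Suc i))"
    by (simp add: eigen_projection_def h_def sum_distrib_left mult_ac)
  also have "\<dots> = (\<Sum>i<totient q. h i)"
    using sum.lessThan_Suc_shift[of h "totient q"] \<open>h (totient q) = h 0\<close> by simp
  finally show ?thesis by (simp add: eigen_projection_def h_def)
qed

text \<open>
  As the projections add up to a nonzero multiple of the identity, every nonzero function has a
  nonzero component in some eigenspace of \<open>g\<close>.
\<close>

lemma sum_eigen_projections:
  assumes "q \<ge> 1"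
  shows "(\<Sum>z | z ^ totient q = 1. eigen_projection q g z f x) = of_nat (totient q) * f x"
proof -
  have "(\<Sum>z | z ^ totient q = 1. eigen_projection q g z f x)
      = (\<Sum>i<totient q. (\<Sum>z | z ^ totient q = 1. z ^ i) * f (g ^ i * x))"
    unfolding eigen_projection_def sum_distrib_right by (rule sum.swap)
  also have "\<dots> = (\<Sum>i<totient q. if i = 0 then of_nat (totient q) * f x else 0)"
    by (intro sum.cong) (auto simp: sum_powers_roots_of_unity)
  also have "\<dots> = of_nat (totient q) * f x" using assms by simp
  finally show ?thesis .
qed

text \<open>
  Because the units commute, projecting for one unit keeps the eigenvalues of the others.
\<close>

lemma eigen_projection_commute:
  assumes "\<forall>x. f (h * x) = c * f x"
  shows "eigen_projection q g z f (h * x) = c * eigen_projection q g z f x"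
proof -
  have "f (g ^ i * (h * x)) = c * f (g ^ i * x)" for i
    using assms[rule_format, of "g ^ i * x"] by (simp add: mult_ac)
  thus ?thesis by (simp add: eigen_projection_def sum_distrib_left mult_ac)
qed

text \<open>
  Decompose the indicator function \<open>\<delta>\<close> of the residue class \<open>1\<close>. If its only nonzero component were
  the one with eigenvalue \<open>1\<close>, then \<open>\<delta>\<close> would be invariant under \<open>g\<close>; but \<open>\<delta>\<close> vanishes at the inverse
  of \<open>g\<close>, whereas its average over the powers of \<open>g\<close> does not.
\<close>

lemma ex_eigenfunction_nontrivial:
  assumes "q \<ge> 1" "coprime g (int q)" "\<not> [g = 1] (mod int q)"
  obtains f c where "unit_function q f" "\<exists>x. f x \<noteq> 0" "c \<noteq> 1" "\<forall>x. f (g * x) = c * f x"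
proof -
  define N where "N = totient q"
  define \<delta> :: "int \<Rightarrow> complex" where "\<delta> x = (if [x = 1] (mod int q) then 1 else 0)" for x
  have \<delta>: "unit_function q \<delta>"
    unfolding unit_function_def \<delta>_def
    by (smt (verit) cong_imp_coprime cong_sym cong_trans coprime_1_left)
  have gN: "[g ^ N = 1] (mod int q)" unfolding N_def using assms(2) by (rule cong_power_totient)
  have N1: "N > 1"
  proof (rule ccontr)
    assume "\<not> N > 1"
    moreover have "N > 0" using assms(1) by (simp add: N_def)
    ultimately have "N = 1" by simp
    thus False using gN assms(3) by simp
  qed
  \<comment> \<open>an inverse of \<open>g\<close> modulo \<open>q\<close>\<close>
  define x where "x = g ^ (N - 1)"
  have gx: "[g * x = 1] (mod int q)"
    using gN N1 unfolding x_def by (metis One_nat_def Suc_diff_1 less_trans power_Suc zero_less_one)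
  have nx: "\<not> [x = 1] (mod int q)"
  proof
    assume "[x = 1] (mod int q)"
    hence "[g * x = g * 1] (mod int q)" by (rule cong_scalar_left)
    thus False using gx assms(3) by (metis cong_sym cong_trans mult.right_neutral)
  qed
  have ne: "eigen_projection q g 1 \<delta> x \<noteq> 0"
  proof -
    define A where "A = {..<N} \<inter> {i. [g ^ i * x = 1] (mod int q)}"
    have "eigen_projection q g 1 \<delta> x = of_nat (card A)"
      unfolding eigen_projection_def \<delta>_def A_def N_def[symmetric]
      by (simp add: sum.If_cases)
    moreover have "1 \<in> A" using gx N1 by (simp add: A_def)
    moreover have "finite A" by (simp add: A_def)
    ultimately show ?thesis by auto
  qed
  have fin: "finite {z::complex. z ^ N = 1}" using N1 by (intro finite_roots_unity) auto
  have "0 = (\<Sum>z | z ^ N = 1. eigen_projection q g z \<delta> x)"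
    using sum_eigen_projections[OF assms(1), of g \<delta> x] nx by (simp add: N_def \<delta>_def)
  also have "\<dots> = eigen_projection q g 1 \<delta> x
      + (\<Sum>z\<in>{z. z ^ N = 1} - {1}. eigen_projection q g z \<delta> x)"
    by (rule sum.remove[OF fin]) simp
  finally have "(\<Sum>z\<in>{z. z ^ N = 1} - {1}. eigen_projection q g z \<delta> x) \<noteq> 0"
    using ne by auto
  then obtain z where z: "z ^ N = 1" "z \<noteq> 1" "eigen_projection q g z \<delta> x \<noteq> 0"
    by (metis (mono_tags, lifting) Diff_iff insertI1 mem_Collect_eq sum.neutral)
  have "z \<noteq> 0" using z(1) N1 by (auto simp: power_0_left)
  show ?thesis
  proof (rule that)
    show "unit_function q (eigen_projection q g z \<delta>)"
      by (rule unit_function_eigen_projection[OF \<delta>])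
    show "\<exists>x. eigen_projection q g z \<delta> x \<noteq> 0" using z(3) by blast
    show "inverse z \<noteq> 1" using z(2) by (metis inverse_1 inverse_inverse_eq)
    show "\<forall>x. eigen_projection q g z \<delta> (g * x) = inverse z * eigen_projection q g z \<delta> x"
      using eigen_projection_shift[OF \<delta> assms(2), of z] z(1) \<open>z \<noteq> 0\<close>
      by (simp add: N_def field_simps)
  qed
qed

lemma ex_common_eigenfunction:
  assumes "q \<ge> 1" "finite S" "\<forall>h\<in>S. coprime h (int q)"
    and "unit_function q f" "\<exists>x. f x \<noteq> 0" "\<forall>x. f (g * x) = c * f x"
  obtains F where "unit_function q F" "\<exists>x. F x \<noteq> 0" "\<forall>x. F (g * x) = c * F x"
    "\<forall>h\<in>S. \<exists>e. \<forall>x. F (h * x) = e * F x"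
proof -
  have "\<exists>F. unit_function q F \<and> (\<exists>x. F x \<noteq> 0) \<and> (\<forall>x. F (g * x) = c * F x) \<and>
    (\<forall>h\<in>S. \<exists>e. \<forall>x. F (h * x) = e * F x)"
    using assms(2,3)
  proof (induction S rule: finite_induct)
    case empty
    thus ?case using assms(4-6) by auto
  next
    case (insert h S)
    then obtain F where F: "unit_function q F" "\<exists>x. F x \<noteq> 0" "\<forall>x. F (g * x) = c * F x"
      "\<forall>h\<in>S. \<exists>e. \<forall>x. F (h * x) = e * F x" by auto
    have h: "coprime h (int q)" using insert.prems by simp
    obtain y where y: "F y \<noteq> 0" using F(2) by blast
    have "(\<Sum>z | z ^ totient q = 1. eigen_projection q h z F y) \<noteq> 0"
      using sum_eigen_projections[OF assms(1), of h F y] y assms(1) by simp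
    then obtain z where z: "z ^ totient q = 1" "eigen_projection q h z F y \<noteq> 0"
      by (metis (mono_tags, lifting) mem_Collect_eq sum.neutral)
    have "z \<noteq> 0" using z(1) assms(1) by (auto simp: power_0_left)
    let ?F = "eigen_projection q h z F"
    have "\<forall>x. ?F (h * x) = inverse z * ?F x"
      using eigen_projection_shift[OF F(1) h z(1)] \<open>z \<noteq> 0\<close> by (simp add: field_simps)
    moreover have "\<exists>e. \<forall>x. ?F (k * x) = e * ?F x" if "k \<in> S" for k
      using F(4) that eigen_projection_commute by meson
    moreover have "\<forall>x. ?F (g * x) = c * ?F x"
      using eigen_projection_commute[OF F(3)] by blast
    moreover have "unit_function q ?F" by (rule unit_function_eigen_projection[OF F(1)])
    ultimately show ?case using z(2) by (intro exI[of _ ?F]) auto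
  qed
  thus ?thesis using that by blast
qed

text \<open>
  Project an eigenfunction of \<open>g\<close> with eigenvalue other than \<open>1\<close> successively for all units. The result
  \<open>F\<close> is still nonzero and is an eigenfunction of every unit; the eigenvalues, read off at a point \<open>y\<close>
  with \<open>F y \<noteq> 0\<close>, form the character. This takes the place of extending a character from the subgroup
  generated by \<open>g\<close>, and no question of well-definedness arises.
\<close>

lemma ex_character_neq_1:
  assumes "q \<ge> 1" "coprime g (int q)" "\<not> [g = 1] (mod int q)"
  obtains \<chi> where "\<chi> \<in> dirichlet_characters q" "\<chi> g \<noteq> 1"
proof -
  obtain f c where f: "unit_function q f" "\<exists>x. f x \<noteq> 0" "\<forall>x. f (g * x) = c * f x" "c \<noteq> 1"
    by (rule ex_eigenfunction_nontrivial[OF assms])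
  define S where "S = {h \<in> {0..<int q}. coprime h (int q)}"
  obtain F where F: "unit_function q F" "\<exists>x. F x \<noteq> 0" "\<forall>x. F (g * x) = c * F x"
    "\<forall>h\<in>S. \<exists>e. \<forall>x. F (h * x) = e * F x"
    by (rule ex_common_eigenfunction[OF assms(1) _ _ f(1-3), of S])
      (auto simp: S_def intro: finite_subset[of _ "{0..<int q}"])
  have per: "F m = F n" if "[m = n] (mod int q)" for m n
    using F(1) that unfolding unit_function_def by blast
  have supp: "F n = 0" if "\<not> coprime n (int q)" for n
    using F(1) that unfolding unit_function_def by blast
  have eig: "\<exists>e. \<forall>x. F (h * x) = e * F x" if "coprime h (int q)" for h
  proof -
    have c: "[h mod int q = h] (mod int q)" by simp
    have "coprime (h mod int q) (int q)"
      using that c cong_imp_coprime cong_sym by blast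
    hence "h mod int q \<in> S" using assms(1) by (simp add: S_def)
    then obtain e where "\<forall>x. F (h mod int q * x) = e * F x" using F(4) by blast
    moreover have "F (h mod int q * x) = F (h * x)" for x
      by (rule per) (rule cong_scalar_right[OF c])
    ultimately show ?thesis by auto
  qed
  obtain y where y: "F y \<noteq> 0" using F(2) by blast
  define \<chi> where "\<chi> n = F (n * y) / F y" for n
  have \<chi>: "F (n * x) = \<chi> n * F x" if n: "coprime n (int q)" for n x
  proof -
    obtain e where e: "\<forall>x. F (n * x) = e * F x" using eig[OF n] by blast
    thus ?thesis using y by (simp add: \<chi>_def)
  qed
  have \<chi>0: "\<chi> n = 0" if "\<not> coprime n (int q)" for n
    using supp[of "n * y"] that by (simp add: \<chi>_def)
  have mult: "\<chi> (m * n) = \<chi> m * \<chi> n" for m n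
  proof (cases "coprime m (int q)")
    case True
    have "\<chi> (m * n) = F (m * (n * y)) / F y" by (simp add: \<chi>_def mult_ac)
    also have "\<dots> = \<chi> m * \<chi> n" by (subst \<chi>[OF True]) (simp add: \<chi>_def)
    finally show ?thesis .
  next
    case False
    thus ?thesis by (simp add: \<chi>0)
  qed
  have cper: "\<chi> m = \<chi> n" if "[m = n] (mod int q)" for m n
    unfolding \<chi>_def by (subst per[OF cong_scalar_right[OF that]]) simp
  have c1: "\<chi> 1 = 1" using y by (simp add: \<chi>_def)
  have "\<chi> n \<noteq> 0" if n: "coprime n (int q)" for n
  proof -
    have "\<chi> (n ^ k) = \<chi> n ^ k" for k by (induction k) (auto simp: c1 mult)
    hence "\<chi> n ^ totient q = \<chi> (n ^ totient q)" by simp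
    also have "\<dots> = 1" using cper[OF cong_power_totient[OF n]] c1 by simp
    finally show ?thesis using assms(1) by (auto simp: power_0_left)
  qed
  hence "\<chi> \<in> dirichlet_characters q"
    using mult cper \<chi>0 unfolding dirichlet_characters_def by blast
  moreover have "\<chi> g = c" using F(3) y by (simp add: \<chi>_def)
  ultimately show ?thesis using that f(4) by blast
qed


text \<open>
  Multiplication by a character \<open>\<psi>\<close> with \<open>\<psi> n \<noteq> 1\<close> permutes the group, so the sum equals \<open>\<psi> n\<close> times
  itself.
\<close>

lemma character_sum_eq_0:
  assumes "q \<ge> 1" "coprime n (int q)" "\<not> [n = 1] (mod int q)"
  shows "(\<Sum>\<chi>\<in>dirichlet_characters q. \<chi> n) = 0"
proof -
  obtain \<psi> where \<psi>: "\<psi> \<in> dirichlet_characters q" "\<psi> n \<noteq> 1"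
    by (rule ex_character_neq_1[OF assms])
  define \<psi>' where "\<psi>' = (\<lambda>m. inverse (\<psi> m))"
  have \<psi>': "\<psi>' \<in> dirichlet_characters q"
    using \<psi>(1) by (auto simp: \<psi>'_def dirichlet_characters_def)
  have mult: "(\<lambda>m. \<chi>1 m * \<chi>2 m) \<in> dirichlet_characters q"
    if "\<chi>1 \<in> dirichlet_characters q" "\<chi>2 \<in> dirichlet_characters q" for \<chi>1 \<chi>2
    using that by (auto simp: dirichlet_characters_def)
  have cancel: "(\<lambda>m. \<psi>1 m * (\<psi>2 m * \<chi> m)) = \<chi>"
    if "\<chi> \<in> dirichlet_characters q" "(\<psi>1, \<psi>2) \<in> {(\<psi>, \<psi>'), (\<psi>', \<psi>)}" for \<chi> \<psi>1 \<psi>2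
  proof
    fix m
    show "\<psi>1 m * (\<psi>2 m * \<chi> m) = \<chi> m"
    proof (cases "coprime m (int q)")
      case True
      hence "\<psi> m \<noteq> 0" using \<psi>(1) by (auto simp: dirichlet_characters_def)
      thus ?thesis using that(2) by (auto simp: \<psi>'_def)
    next
      case False
      hence "\<chi> m = 0" using that(1) by (auto simp: dirichlet_characters_def)
      thus ?thesis by simp
    qed
  qed
  have "(\<Sum>\<chi>\<in>dirichlet_characters q. \<chi> n) = (\<Sum>\<chi>\<in>dirichlet_characters q. \<psi> n * \<chi> n)"
    by (rule sum.reindex_bij_witness[where j = "\<lambda>\<chi> m. \<psi>' m * \<chi> m" and i = "\<lambda>\<chi> m. \<psi> m * \<chi> m"])
      (use mult \<psi>(1) \<psi>' cancel in \<open>auto simp: fun_eq_iff\<close>)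
  also have "\<dots> = \<psi> n * (\<Sum>\<chi>\<in>dirichlet_characters q. \<chi> n)"
    by (simp add: sum_distrib_left)
  finally show ?thesis using \<psi>(2) by simp
qed

lemma character_mult:
  "\<chi> \<in> dirichlet_characters q \<Longrightarrow> \<chi> (m * n) = \<chi> m * \<chi> n"
  unfolding dirichlet_characters_def by blast

lemma character_cong:
  "\<chi> \<in> dirichlet_characters q \<Longrightarrow> [m = n] (mod int q) \<Longrightarrow> \<chi> m = \<chi> n"
  unfolding dirichlet_characters_def by blast

lemma character_1:
  assumes "\<chi> \<in> dirichlet_characters q"
  shows "\<chi> 1 = 1"
proof -
  have "\<chi> (1 * 1) = \<chi> 1 * \<chi> 1" "\<chi> 1 \<noteq> 0"
    using assms unfolding dirichlet_characters_def by (blast, simp)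
  thus ?thesis by simp
qed

lemma card_reduced_residues:
  assumes "q \<ge> 1"
  shows "card {n \<in> {0..<int q}. coprime n (int q)} = totient q"
proof (cases "q = 1")
  case True
  hence "{n \<in> {0..<int q}. coprime n (int q)} = {0}" by auto
  thus ?thesis using True by simp
next
  case False
  hence q: "q > 1" using assms by simp
  have "{n \<in> {0..<int q}. coprime n (int q)} = int ` totatives q"
  proof (intro equalityI subsetI)
    fix n assume n: "n \<in> {n \<in> {0..<int q}. coprime n (int q)}"
    hence "n \<noteq> 0" using q by (auto intro: Nat.gr0I)
    hence "nat n \<in> totatives q" "n = int (nat n)" using n
      by (auto simp: in_totatives_iff simp flip: coprime_int_iff)
    thus "n \<in> int ` totatives q" by blast
  qed (use q totatives_less in \<open>auto simp: in_totatives_iff\<close>)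
  thus ?thesis by (simp add: card_image totient_def)
qed

lemma sum_character_eq_0:
  assumes "q \<ge> 1" "\<chi> \<in> dirichlet_characters q" "coprime g (int q)" "\<chi> g \<noteq> 1"
  shows "(\<Sum>n | n \<in> {0..<int q} \<and> coprime n (int q). \<chi> n) = 0"
proof -
  define R where "R = {n \<in> {0..<int q}. coprime n (int q)}"
  have "finite R" by (rule finite_subset[of _ "{0..<int q}"]) (auto simp: R_def)
  moreover have "(\<lambda>n. (g * n) mod int q) ` R \<subseteq> R"
    using assms(1,3) by (auto simp: R_def)
  moreover have "inj_on (\<lambda>n. (g * n) mod int q) R"
  proof (rule inj_onI)
    fix m n assume mn: "m \<in> R" "n \<in> R" "(g * m) mod int q = (g * n) mod int q"
    hence "[m = n] (mod int q)"
      using assms(3) by (simp add: cong_def[symmetric] cong_mult_lcancel)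
    thus "m = n" using mn by (auto simp: R_def cong_def)
  qed
  ultimately have bij: "bij_betw (\<lambda>n. (g * n) mod int q) R R"
    by (simp add: bij_betw_def endo_inj_surj)
  have "\<chi> ((g * n) mod int q) = \<chi> g * \<chi> n" for n
    using character_cong[OF assms(2), of "(g * n) mod int q" "g * n"] character_mult[OF assms(2)]
    by simp
  hence "(\<Sum>n\<in>R. \<chi> n) = \<chi> g * (\<Sum>n\<in>R. \<chi> n)"
    using sum.reindex_bij_betw[OF bij, of \<chi>] by (simp add: sum_distrib_left)
  thus ?thesis using assms(4) by (simp add: R_def)
qed

text \<open>
  Count the double sum of \<open>\<chi> n\<close> over all characters and all reduced residues in two ways: summing over
  the characters first, only \<open>n = 1\<close> contributes; summing over the residues first, only the principal
  character does.
\<close>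

lemma card_dirichlet_characters:
  assumes "q \<ge> 1"
  shows "card (dirichlet_characters q) = totient q"
proof -
  define R where "R = {n \<in> {0..<int q}. coprime n (int q)}"
  have fin: "finite R" by (rule finite_subset[of _ "{0..<int q}"]) (auto simp: R_def)
  define \<chi>0 where "\<chi>0 = (\<lambda>n. if coprime n (int q) then 1 else 0 :: complex)"
  have \<chi>0: "\<chi>0 \<in> dirichlet_characters q"
    by (auto simp: \<chi>0_def dirichlet_characters_def dest: cong_imp_coprime cong_sym)
  have one: "1 mod int q \<in> R"
    using assms by (simp add: R_def)
  have "of_nat (card (dirichlet_characters q)) = (\<Sum>\<chi>\<in>dirichlet_characters q. \<chi> (1 mod int q))"
  proof -
    have "\<chi> (1 mod int q) = 1" if "\<chi> \<in> dirichlet_characters q" for \<chi>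
      using character_cong[OF that, of "1 mod int q" 1] character_1[OF that] by simp
    hence "(\<Sum>\<chi>\<in>dirichlet_characters q. \<chi> (1 mod int q)) = (\<Sum>\<chi>\<in>dirichlet_characters q. 1)"
      by (rule sum.cong[OF refl])
    thus ?thesis by simp
  qed
  also have "\<dots> = (\<Sum>n\<in>R. \<Sum>\<chi>\<in>dirichlet_characters q. \<chi> n)"
  proof -
    have "(\<Sum>\<chi>\<in>dirichlet_characters q. \<chi> n) = 0" if "n \<in> R - {1 mod int q}" for n
      using that by (intro character_sum_eq_0[OF assms]) (auto simp: R_def cong_def)
    hence "(\<Sum>n\<in>{1 mod int q}. \<Sum>\<chi>\<in>dirichlet_characters q. \<chi> n)
        = (\<Sum>n\<in>R. \<Sum>\<chi>\<in>dirichlet_characters q. \<chi> n)"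
      using one by (intro sum.mono_neutral_left[OF fin]) auto
    thus ?thesis by simp
  qed
  also have "\<dots> = (\<Sum>\<chi>\<in>dirichlet_characters q. \<Sum>n\<in>R. \<chi> n)"
    by (rule sum.swap)
  also have "\<dots> = (\<Sum>\<chi>\<in>dirichlet_characters q. if \<chi> = \<chi>0 then of_nat (card R) else 0)"
  proof (rule sum.cong[OF refl])
    fix \<chi> assume \<chi>: "\<chi> \<in> dirichlet_characters q"
    show "(\<Sum>n\<in>R. \<chi> n) = (if \<chi> = \<chi>0 then of_nat (card R) else 0)"
    proof (cases "\<chi> = \<chi>0")
      case True
      thus ?thesis by (simp add: \<chi>0_def R_def)
    next
      case False
      then obtain g where g: "\<chi> g \<noteq> \<chi>0 g" by blast
      hence "coprime g (int q)" using \<chi> by (auto simp: \<chi>0_def dirichlet_characters_def)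
      hence "(\<Sum>n\<in>R. \<chi> n) = 0"
        using sum_character_eq_0[OF assms \<chi>, of g] g by (simp add: R_def \<chi>0_def)
      thus ?thesis using False by simp
    qed
  qed
  also have "\<dots> = of_nat (totient q)"
    using \<chi>0 finite_dirichlet_characters[OF assms] card_reduced_residues[OF assms]
    by (simp add: R_def)
  finally show ?thesis by (simp only: of_nat_eq_iff)
qed

text \<open>
  On units a character takes values of modulus one, so the conjugate of \<open>\<chi> a\<close> is the value of \<open>\<chi>\<close> at an
  inverse \<open>a'\<close> of \<open>a\<close>, and the sum is a character sum at \<open>a' * n\<close>.
\<close>

lemma character_orthogonality:
  assumes "q \<ge> 1" "coprime a (int q)"
  shows "(\<Sum>\<chi>\<in>dirichlet_characters q. cnj (\<chi> a) * \<chi> n) =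
           (if [n = a] (mod int q) then of_nat (totient q) else 0)"
proof (cases "coprime n (int q)")
  case False
  hence "\<not> [n = a] (mod int q)" using assms(2) cong_imp_coprime cong_sym by blast
  moreover have "\<chi> n = 0" if "\<chi> \<in> dirichlet_characters q" for \<chi>
    using that False by (auto simp: dirichlet_characters_def)
  hence "(\<Sum>\<chi>\<in>dirichlet_characters q. cnj (\<chi> a) * \<chi> n) = 0"
    by (intro sum.neutral) auto
  ultimately show ?thesis by simp
next
  case True
  define a' where "a' = a ^ (totient q - 1)"
  have aa': "[a * a' = 1] (mod int q)"
    using cong_power_totient[OF assms(2)] assms(1) by (simp add: a'_def flip: power_Suc)
  have cnj: "cnj (\<chi> a) = \<chi> a'" if \<chi>: "\<chi> \<in> dirichlet_characters q" for \<chi>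
  proof -
    have "\<chi> (a * a') = \<chi> 1"
      by (rule character_cong[OF \<chi> aa'])
    hence "\<chi> a * \<chi> a' = 1" by (simp add: character_mult[OF \<chi>] character_1[OF \<chi>])
    moreover have "norm (\<chi> a) ^ totient q = 1"
      using character_pow_totient[OF \<chi> assms] by (metis norm_one norm_power)
    hence "norm (\<chi> a) = 1"
      using power_eq_imp_eq_base[of "norm (\<chi> a)" "totient q" 1] assms(1) by simp
    hence "\<chi> a * cnj (\<chi> a) = 1" by (simp add: complex_norm_square[symmetric])
    ultimately show ?thesis by (metis mult_cancel_left mult_zero_left zero_neq_one)
  qed
  have "(\<Sum>\<chi>\<in>dirichlet_characters q. cnj (\<chi> a) * \<chi> n) = (\<Sum>\<chi>\<in>dirichlet_characters q. \<chi> (a' * n))"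
    by (intro sum.cong) (auto simp: cnj character_mult)
  also have "\<dots> = (if [n = a] (mod int q) then of_nat (totient q) else 0)"
  proof (cases "[n = a] (mod int q)")
    case True
    have "[a' * n = 1] (mod int q)"
      using aa' True by (metis cong_scalar_left cong_trans mult.commute)
    hence "\<chi> (a' * n) = 1" if "\<chi> \<in> dirichlet_characters q" for \<chi>
      using character_cong[OF that] character_1[OF that] by metis
    hence "(\<Sum>\<chi>\<in>dirichlet_characters q. \<chi> (a' * n)) = (\<Sum>\<chi>\<in>dirichlet_characters q. 1)"
      by (rule sum.cong[OF refl])
    thus ?thesis using True card_dirichlet_characters[OF assms(1)] by simp
  next
    case False
    have "\<not> [a' * n = 1] (mod int q)"
    proof
      assume "[a' * n = 1] (mod int q)"
      hence "[a * (a' * n) = a * 1] (mod int q)" by (rule cong_scalar_left)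
      moreover have "[a * a' * n = 1 * n] (mod int q)" using aa' by (rule cong_scalar_right)
      ultimately have "[n = a] (mod int q)"
        by (metis cong_sym cong_trans mult.assoc mult.left_neutral mult.right_neutral)
      thus False using False by simp
    qed
    moreover have "coprime (a' * n) (int q)" using True assms(2) by (simp add: a'_def)
    ultimately show ?thesis using character_sum_eq_0[OF assms(1)] False by simp
  qed
  finally show ?thesis .
qed

section \<open>Divisor sums of the Moebius function\<close>

lemma moebius_mu_prime_mult:
  assumes "prime p" "\<not> p dvd d" "d > 0"
  shows "moebius_mu (p * d) = - moebius_mu d"
proof -
  have cop: "coprime p d" using assms by (simp add: prime_imp_coprime)
  have "squarefree (p * d) \<longleftrightarrow> squarefree d"
    using squarefree_mult_coprime[OF cop] squarefree_prime[OF assms(1)] squarefree_multD by blast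
  moreover have "prime_factors (p * d) = insert p (prime_factors d)"
    using assms by (auto simp: prime_factorization_mult prime_factorization_prime)
  moreover have "p \<notin> prime_factors d" using assms by auto
  ultimately show ?thesis by (simp add: moebius_mu_def)
qed

lemma moebius_mu_eq_0:
  assumes "prime p" "p dvd d"
  shows "moebius_mu (p * d) = 0"
proof -
  have "\<not> squarefree (p * d)"
    using assms by (intro not_squarefreeI[of p]) (auto simp: power2_eq_square)
  thus ?thesis by (simp add: moebius_mu_def)
qed

text \<open>
  Fix a prime \<open>p\<close> dividing \<open>n\<close>. Multiplication by \<open>p\<close> pairs the divisors prime to \<open>p\<close> with divisors
  carrying the opposite value, and \<open>moebius_mu\<close> vanishes at the remaining ones, which are divisible by
  the square of \<open>p\<close>.
\<close>

lemma sum_moebius_mu_divisors: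
  assumes "n > 0"
  shows "(\<Sum>d | d dvd n. moebius_mu d) = (if n = 1 then 1 else 0)"
proof (cases "n = 1")
  case True
  thus ?thesis by (simp add: moebius_mu_def)
next
  case False
  then obtain p where p: "prime p" "p dvd n" using prime_factor_nat by blast
  have p0: "p > 0" using p(1) by (simp add: prime_gt_0_nat)
  let ?D = "{d. d dvd n}"
  have fin: "finite ?D" using assms by simp
  have "(\<Sum>d | d dvd n \<and> p dvd d. moebius_mu d) = (\<Sum>d | p * d dvd n. moebius_mu (p * d))"
    by (rule sum.reindex_bij_witness[where i = "\<lambda>d. p * d" and j = "\<lambda>d. d div p"])
      (use p0 in \<open>auto\<close>)
  also have "\<dots> = (\<Sum>d | p * d dvd n \<and> \<not> p dvd d. moebius_mu (p * d))"
    by (rule sum.mono_neutral_right)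
      (auto intro!: finite_subset[OF _ fin] moebius_mu_eq_0[OF p(1)] dest: dvd_mult_right)
  also have "\<dots> = (\<Sum>d | d dvd n \<and> \<not> p dvd d. - moebius_mu d)"
  proof (rule sum.cong)
    have "coprime p d" if "\<not> p dvd d" for d using p(1) that by (rule prime_imp_coprime)
    thus "{d. p * d dvd n \<and> \<not> p dvd d} = {d. d dvd n \<and> \<not> p dvd d}"
      using p(2) by (auto intro: divides_mult dest: dvd_mult_right)
    fix d assume "d \<in> {d. d dvd n \<and> \<not> p dvd d}"
    thus "moebius_mu (p * d) = - moebius_mu d"
      using moebius_mu_prime_mult[OF p(1)] assms by (auto intro: Nat.gr0I)
  qed
  finally have "(\<Sum>d | d dvd n \<and> p dvd d. moebius_mu d)
      = - (\<Sum>d | d dvd n \<and> \<not> p dvd d. moebius_mu d)"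
    by (simp add: sum_negf)
  moreover have "(\<Sum>d | d dvd n. moebius_mu d) = (\<Sum>d | d dvd n \<and> p dvd d. moebius_mu d)
      + (\<Sum>d | d dvd n \<and> \<not> p dvd d. moebius_mu d)"
    by (subst sum.union_disjoint[symmetric]) (use assms in \<open>auto intro!: sum.cong\<close>)
  ultimately show ?thesis using False by simp
qed

text \<open>
  With \<open>n = d * (m div l)\<close> the pairs \<open>d dvd l dvd m\<close> correspond to the pairs \<open>d dvd n dvd m\<close>, and for
  fixed \<open>n\<close> the inner sum of \<open>moebius_mu d\<close> leaves only \<open>n = 1\<close>.
\<close>

lemma sum_moebius_mu_convolution:
  fixes b :: "nat \<Rightarrow> complex"
  assumes "m > 0"
  shows "(\<Sum>l | l dvd m. \<Sum>d | d dvd l. of_int (moebius_mu d) * b (d * (m div l))) = b 1"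
proof -
  have fin: "finite {d. d dvd n}" if "n dvd m" for n using assms that
    by (metis dvd_pos_nat finite_divisors_nat)
  have "(\<Sum>l | l dvd m. \<Sum>d | d dvd l. of_int (moebius_mu d) * b (d * (m div l)))
     = (\<Sum>(l, d)\<in>Sigma {l. l dvd m} (\<lambda>l. {d. d dvd l}). of_int (moebius_mu d) * b (d * (m div l)))"
    by (rule sum.Sigma) (use assms fin in auto)
  also have "\<dots> = (\<Sum>(n, d)\<in>Sigma {l. l dvd m} (\<lambda>l. {d. d dvd l}). of_int (moebius_mu d) * b n)"
    by (rule sum.reindex_bij_witness[where i = "\<lambda>(n, d). (d * (m div n), d)"
          and j = "\<lambda>(l, d). (d * (m div l), d)"])
      (use assms in \<open>auto elim!: dvdE simp: mult_ac\<close>)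
  also have "\<dots> = (\<Sum>n | n dvd m. \<Sum>d | d dvd n. of_int (moebius_mu d) * b n)"
    by (rule sum.Sigma[symmetric]) (use assms fin in auto)
  also have "\<dots> = (\<Sum>n | n dvd m. of_int (\<Sum>d | d dvd n. moebius_mu d) * b n)"
    by (simp add: sum_distrib_right)
  also have "\<dots> = (\<Sum>n | n dvd m. if n = 1 then b 1 else 0)"
    using assms by (intro sum.cong) (auto simp: sum_moebius_mu_divisors dvd_pos_nat)
  also have "\<dots> = b 1" using assms by simp
  finally show ?thesis .
qed

text \<open>
  Since the values of \<open>moebius_mu\<close> over the divisors cancel, \<open>b d\<close> may be replaced by \<open>b d - 1 / 2\<close>, which
  has modulus \<open>1 / 2\<close>. The factor \<open>1 / 2\<close> gained over the trivial bound is what brings the final constant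
  below \<open>1\<close>.
\<close>

lemma norm_sum_moebius_mu_le:
  fixes b :: "nat \<Rightarrow> complex"
  assumes "l \<ge> 2" "\<And>d. b d \<in> {0, 1}"
  shows "norm (\<Sum>d | d dvd l. of_int (moebius_mu d) * b d) \<le> real l / 2"
proof -
  have "(\<Sum>d | d dvd l. of_int (moebius_mu d) * (1 / 2 :: complex))
      = of_int (\<Sum>d | d dvd l. moebius_mu d) / 2"
    by (simp add: sum_divide_distrib)
  also have "\<dots> = 0" using assms(1) by (simp add: sum_moebius_mu_divisors)
  finally have "(\<Sum>d | d dvd l. of_int (moebius_mu d) * b d)
      = (\<Sum>d | d dvd l. of_int (moebius_mu d) * (b d - 1 / 2))"
    by (simp add: ring_distribs sum_subtractf)
  also have "norm \<dots> \<le> (\<Sum>d | d dvd l. 1 / 2)"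
  proof (rule sum_norm_le)
    fix d
    have "norm (b d - 1 / 2) = 1 / 2" using assms(2)[of d] by (auto simp: norm_divide)
    moreover have "norm (of_int (moebius_mu d) :: complex) \<le> 1"
      by (simp add: moebius_mu_def norm_power)
    ultimately show "norm (of_int (moebius_mu d) * (b d - 1 / 2)) \<le> 1 / 2"
      using mult_right_mono[of "norm (of_int (moebius_mu d) :: complex)" 1 "1 / 2"]
      by (simp only: norm_mult)
  qed
  also have "\<dots> \<le> real l / 2"
  proof -
    have "{d. d dvd l} \<subseteq> {1..l}"
      using assms(1) dvd_imp_le[of _ l] dvd_pos_nat[of l] by (fastforce simp: Suc_le_eq)
    from card_mono[OF _ this] show ?thesis by simp
  qed
  finally show ?thesis .
qed

section \<open>The Moebius logarithm series\<close>

lemma has_sum_log_series: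
  fixes x :: complex
  assumes "norm x < 1"
  shows "((\<lambda>k. x ^ k / of_nat k) has_sum - Ln (1 - x)) {1::nat..}"
proof -
  have "(\<lambda>n. - ((- (- x)) ^ n) / of_nat n) sums Ln (1 + (- x))"
    by (rule Ln_series') (use assms in simp)
  from sums_minus[OF this] have S: "(\<lambda>n. x ^ n / of_nat n) sums - Ln (1 - x)" by simp
  have "summable (\<lambda>n. norm (x ^ n / of_nat n))"
  proof (rule summable_comparison_test')
    show "summable (\<lambda>n. norm x ^ n)" using assms by (intro summable_geometric) auto
    show "norm (norm (x ^ n / of_nat n)) \<le> norm x ^ n" if "n \<ge> 0" for n
      using mult_right_mono[of 1 "real n" "norm x ^ n"]
      by (cases "n = 0") (auto simp: norm_divide norm_power divide_le_eq mult.commute)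
  qed
  from norm_summable_imp_has_sum[OF this S] show ?thesis
    by (rule has_sum_cong_neutral[THEN iffD1, rotated -1]) (auto simp: not_le)
qed

lemma has_sum_geometric_multiples:
  fixes r :: real
  assumes "0 \<le> r" "r < 1" "l \<ge> 1"
  shows "((\<lambda>k. r ^ (l * k)) has_sum (r ^ l / (1 - r ^ l))) {1..}"
proof -
  have "r ^ l \<le> r ^ 1" using assms by (intro power_decreasing) auto
  hence "norm (r ^ l) < 1" using assms by simp
  from has_sum_geometric_from_1[OF this] show ?thesis by (simp add: power_mult)
qed

lemma summable_on_lambert_series:
  fixes r :: real
  assumes "0 \<le> r" "r < 1"
  shows "(\<lambda>(l, k). r ^ (l * k)) summable_on ({1..} \<times> {1..})"
proof (rule summable_on_SigmaI)
  fix l :: nat assume "l \<in> {1..}"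
  thus "((\<lambda>k. case (l, k) of (l, k) \<Rightarrow> r ^ (l * k)) has_sum (r ^ l / (1 - r ^ l))) {1..}"
    using has_sum_geometric_multiples[OF assms, of l] by simp
next
  have "(\<lambda>l. norm (r ^ l / (1 - r ^ l))) summable_on {1..}"
  proof (rule Infinite_Sum.abs_summable_on_comparison_test')
    show "(\<lambda>l. r ^ l * (1 / (1 - r))) summable_on {1..}"
      using has_sum_geometric_from_1[of r] assms
      by (intro summable_on_cmult_left has_sum_imp_summable) auto
    fix l :: nat assume "l \<in> {1..}"
    hence "r ^ l \<le> r ^ 1" using assms by (intro power_decreasing) auto
    thus "norm (r ^ l / (1 - r ^ l)) \<le> r ^ l * (1 / (1 - r))"
      using assms by (auto intro!: divide_left_mono mult_pos_pos)
  qed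
  thus "(\<lambda>l. r ^ l / (1 - r ^ l)) summable_on {1..}"
    by (rule summable_on_iff_abs_summable_on_real[THEN iffD2])
qed (use assms in auto)

text \<open>
  For \<open>x = 1 / p powr s\<close> and \<open>b\<close> the indicator of \<open>p ^ n \<equiv> a\<close>, this is the contribution of the prime power
  \<open>p ^ (l * k)\<close> to the \<open>l\<close>-th summand of the truncated sum, after the characters have been summed out.
\<close>

definition moebius_log_term :: "(nat \<Rightarrow> complex) \<Rightarrow> complex \<Rightarrow> nat \<Rightarrow> nat \<Rightarrow> complex" where
  "moebius_log_term b x l k =
     (\<Sum>d | d dvd l. of_int (moebius_mu d) * b (d * k)) / of_nat (l * k) * x ^ (l * k)"

lemma norm_moebius_log_term_le:
  assumes "\<And>n. b n \<in> {0, 1}" "l \<ge> 2" "k \<ge> 1"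
  shows "norm (moebius_log_term b x l k) \<le> 1 / 2 * norm x ^ (l * k)"
proof -
  have "norm (\<Sum>d | d dvd l. of_int (moebius_mu d) * b (d * k)) / real (l * k)
      \<le> (real l / 2) / real (l * k)"
    using assms by (intro divide_right_mono norm_sum_moebius_mu_le) auto
  also have "\<dots> \<le> 1 / 2" using assms by (simp add: field_simps)
  finally show ?thesis
    unfolding moebius_log_term_def norm_mult norm_divide norm_power norm_of_nat
    by (intro mult_right_mono) auto
qed

lemma norm_moebius_log_term_le':
  assumes "\<And>n. b n \<in> {0, 1}" "l \<ge> 1" "k \<ge> 1"
  shows "norm (moebius_log_term b x l k) \<le> norm x ^ (l * k)"
proof (cases "l = 1")
  case True
  have "norm (b k) \<le> 1" using assms(1)[of k] by auto
  hence "norm (b k) / real k \<le> 1" using assms(3) by (simp add: field_simps)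
  hence "norm (b k) / real k * norm x ^ k \<le> 1 * norm x ^ k" by (intro mult_right_mono) auto
  thus ?thesis using True
    by (simp add: moebius_log_term_def moebius_mu_def norm_mult norm_divide norm_power)
next
  case False
  hence "norm (moebius_log_term b x l k) \<le> 1 / 2 * norm x ^ (l * k)"
    using assms by (intro norm_moebius_log_term_le) auto
  also have "\<dots> \<le> norm x ^ (l * k)" by simp
  finally show ?thesis .
qed

lemma moebius_log_term_summable:
  assumes "\<And>n. b n \<in> {0, 1}" "norm x < 1"
  shows "(\<lambda>(l, k). moebius_log_term b x l k) summable_on ({1..} \<times> {1..})"
  by (rule abs_summable_summable, rule Infinite_Sum.abs_summable_on_comparison_test',
      rule summable_on_lambert_series[of "norm x"])
    (use assms norm_moebius_log_term_le'[OF assms(1)] in auto)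

text \<open>
  The double series converges absolutely, hence may be regrouped by \<open>m = l * k\<close>. The Moebius convolution
  collapses the coefficient of \<open>x ^ m / of_nat m\<close> to \<open>b 1\<close>, which leaves the logarithm series.
\<close>

lemma moebius_log_series:
  assumes "\<And>n. b n \<in> {0, 1}" "norm x < 1"
  shows "((\<lambda>l. \<Sum>\<^sub>\<infinity>k\<in>{1..}. moebius_log_term b x l k) has_sum - (b 1 * Ln (1 - x))) {1..}"
proof -
  let ?F = "\<lambda>(l, k). moebius_log_term b x l k"
  define S where "S = infsum ?F ({1..} \<times> {1..})"
  have F: "(?F has_sum S) ({1..} \<times> {1..})"
    unfolding S_def by (rule has_sum_infsum) (rule moebius_log_term_summable[OF assms])
  have "(moebius_log_term b x l has_sum (\<Sum>\<^sub>\<infinity>k\<in>{1..}. moebius_log_term b x l k)) {1..}"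
    if "l \<in> {1..}" for l
    using summable_on_SigmaD1[OF moebius_log_term_summable[OF assms] that] by (rule has_sum_infsum)
  hence *: "((\<lambda>l. \<Sum>\<^sub>\<infinity>k\<in>{1..}. moebius_log_term b x l k) has_sum S) {1..}"
    by (intro has_sum_SigmaD[OF F]) auto
  have "((\<lambda>(m, l). moebius_log_term b x l (m div l)) has_sum S) (Sigma {1..} (\<lambda>m. {l. l dvd m}))
      \<longleftrightarrow> (?F has_sum S) ({1..} \<times> {1..})"
    by (rule has_sum_reindex_bij_witness[where i = "\<lambda>(l, k). (l * k, l)" and j = "\<lambda>(m, l). (l, m div l)"])
      (auto simp: Suc_le_eq intro: dvd_pos_nat elim!: dvdE)
  hence "((\<lambda>(m, l). moebius_log_term b x l (m div l)) has_sum S) (Sigma {1..} (\<lambda>m. {l. l dvd m}))"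
    using F by simp
  hence "((\<lambda>m. \<Sum>l | l dvd m. moebius_log_term b x l (m div l)) has_sum S) {1..}"
    by (rule has_sum_SigmaD) (auto intro!: has_sum_finite finite_divisors_nat)
  also have "?this \<longleftrightarrow> ((\<lambda>m. b 1 * (x ^ m / of_nat m)) has_sum S) {1..}"
  proof (rule has_sum_cong)
    fix m :: nat assume m: "m \<in> {1..}"
    have "(\<Sum>l | l dvd m. moebius_log_term b x l (m div l))
        = (\<Sum>l | l dvd m. (\<Sum>d | d dvd l. of_int (moebius_mu d) * b (d * (m div l))) * (x ^ m / of_nat m))"
      by (intro sum.cong) (auto simp: moebius_log_term_def)
    also have "\<dots> = b 1 * (x ^ m / of_nat m)"
      unfolding sum_distrib_right[symmetric] using sum_moebius_mu_convolution[of m b] m by simp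
    finally show "(\<Sum>l | l dvd m. moebius_log_term b x l (m div l)) = b 1 * (x ^ m / of_nat m)" .
  qed
  finally have "((\<lambda>m. b 1 * (x ^ m / of_nat m)) has_sum S) {1..}" .
  moreover have "((\<lambda>m. b 1 * (x ^ m / of_nat m)) has_sum (b 1 * - Ln (1 - x))) {1..}"
    by (intro has_sum_cmult_right has_sum_log_series assms)
  ultimately have "S = b 1 * - Ln (1 - x)" by (rule has_sum_unique)
  thus ?thesis using * by simp
qed

text \<open>
  The left-hand side is the modulus of the tail over \<open>l > L\<close>. As \<open>l \<ge> 3\<close> and \<open>norm x \<le> 1 / 2\<close>, the geometric series over \<open>k\<close>
  exceeds its first term by a factor of at most \<open>8 / 7\<close>; half of this is the constant \<open>4 / 7\<close>.
\<close>

lemma truncated_moebius_log_series: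
  assumes "\<And>n. b n \<in> {0, 1}" "norm x \<le> 1 / 2" "L \<ge> 2"
  shows "norm ((\<Sum>l = 1..L. \<Sum>\<^sub>\<infinity>k\<in>{1..}. moebius_log_term b x l k) + b 1 * Ln (1 - x))
     \<le> 4 / 7 * (norm x ^ (L + 1) / (1 - norm x))"
proof -
  define u where "u l = (\<Sum>\<^sub>\<infinity>k\<in>{1..}. moebius_log_term b x l k)" for l
  define r where "r = norm x"
  have r: "0 \<le> r" "r < 1" "r \<le> 1 / 2" using assms(2) by (auto simp: r_def)
  have x: "norm x < 1" using assms(2) by simp
  have u: "(u has_sum - (b 1 * Ln (1 - x))) {1..}"
    unfolding u_def by (rule moebius_log_series[OF assms(1) x])
  define T where "T = infsum u {L<..}"
  have "u summable_on {L<..}"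
    by (rule summable_on_subset_banach[OF has_sum_imp_summable[OF u]]) auto
  hence T: "(u has_sum T) {L<..}" unfolding T_def by (rule has_sum_infsum)
  have "(u has_sum (sum u {1..L} + T)) ({1..L} \<union> {L<..})"
    by (intro has_sum_Un_disjoint T has_sum_finite) auto
  moreover have "{1..L} \<union> {L<..} = {1..}" using assms(3) by auto
  ultimately have "sum u {1..L} + T = - (b 1 * Ln (1 - x))" using u has_sum_unique by metis
  hence "sum u {1..L} + b 1 * Ln (1 - x) = - T" by (metis add.commute add.left_commute add_minus_cancel minus_minus neg_eq_iff_add_eq_0)
  moreover have "norm T \<le> 4 / 7 * (r ^ (L + 1) / (1 - r))"
  proof (rule norm_infsum_le[OF T])
    have "((\<lambda>n. r ^ L * r ^ n) has_sum (r ^ L * (r / (1 - r)))) {1..}"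
      using r by (intro has_sum_cmult_right has_sum_geometric_from_1) auto
    also have "?this \<longleftrightarrow> ((\<lambda>n. r ^ n) has_sum (r ^ (L + 1) / (1 - r))) {L<..}"
      by (rule has_sum_reindex_bij_witness[where i = "\<lambda>n. n - L" and j = "\<lambda>n. n + L"])
        (auto simp: power_add mult_ac)
    finally show "((\<lambda>n. 4 / 7 * r ^ n) has_sum (4 / 7 * (r ^ (L + 1) / (1 - r)))) {L<..}"
      by (rule has_sum_cmult_right)
    fix l assume "l \<in> {L<..}"
    hence l: "l \<ge> 3" using assms(3) by simp
    have "norm (u l) \<le> 1 / 2 * (r ^ l / (1 - r ^ l))"
    proof (rule norm_infsum_le)
      show "(moebius_log_term b x l has_sum u l) {1..}"
        unfolding u_def
        by (rule has_sum_infsum, rule summable_on_SigmaD1[OF moebius_log_term_summable[OF assms(1) x]])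
          (use l in auto)
      show "((\<lambda>k. 1 / 2 * r ^ (l * k)) has_sum (1 / 2 * (r ^ l / (1 - r ^ l)))) {1..}"
        using r l by (intro has_sum_cmult_right has_sum_geometric_multiples) auto
      show "norm (moebius_log_term b x l k) \<le> 1 / 2 * r ^ (l * k)" if "k \<in> {1..}" for k
        unfolding r_def using that l by (intro norm_moebius_log_term_le assms(1)) auto
    qed
    also have "r ^ l \<le> 1 / 8"
    proof -
      have "r ^ l \<le> r ^ 3" using r l by (intro power_decreasing) auto
      also have "\<dots> \<le> (1 / 2) ^ 3" using r by (intro power_mono) auto
      finally show ?thesis by (simp add: power3_eq_cube)
    qed
    hence "r ^ l / (1 - r ^ l) \<le> r ^ l / (7 / 8)"
      using r by (intro divide_left_mono) auto
    hence "1 / 2 * (r ^ l / (1 - r ^ l)) \<le> 1 / 2 * (r ^ l / (7 / 8))"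
      by (intro mult_left_mono) auto
    also have "\<dots> = 4 / 7 * r ^ l" by simp
    finally show "norm (u l) \<le> 4 / 7 * r ^ l" .
  qed
  ultimately show ?thesis by (simp add: u_def r_def)
qed

section \<open>Summation over primes\<close>

lemma has_sum_sum:
  fixes f :: "'i \<Rightarrow> 'a \<Rightarrow> 'b :: topological_comm_monoid_add"
  assumes "\<And>i. i \<in> I \<Longrightarrow> (f i has_sum S i) A"
  shows "((\<lambda>x. \<Sum>i\<in>I. f i x) has_sum (\<Sum>i\<in>I. S i)) A"
  using assms by (induction I rule: infinite_finite_induct) (auto intro!: has_sum_add)

lemma character_power:
  assumes "\<chi> \<in> dirichlet_characters q"
  shows "\<chi> (n ^ k) = \<chi> n ^ k"
  by (induction k) (simp_all add: character_1[OF assms] character_mult[OF assms])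

text \<open>
  The restriction to \<open>d \<ge> 1\<close> matters for the values: at arguments not prime to \<open>q\<close> the zeroth power
  in the character group vanishes, whereas \<open>\<chi> n ^ 0 = 1\<close>.
\<close>

lemma character_group_pow:
  assumes "\<chi> \<in> dirichlet_characters q" "d \<ge> 1"
  shows "\<chi> [^]\<^bsub>character_group q\<^esub> d \<in> dirichlet_characters q"
    and "(\<chi> [^]\<^bsub>character_group q\<^esub> d) n = \<chi> n ^ d"
proof -
  interpret comm_group "character_group q" by (rule comm_group_character_group)
  have carrier: "carrier (character_group q) = dirichlet_characters q"
    by (simp add: character_group_def)
  show "\<chi> [^]\<^bsub>character_group q\<^esub> d \<in> dirichlet_characters q"
    using nat_pow_closed[of \<chi> d] assms(1) by (simp add: carrier)
  have mult: "(\<chi>1 \<otimes>\<^bsub>character_group q\<^esub> \<chi>2) n = \<chi>1 n * \<chi>2 n" for \<chi>1 \<chi>2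
    by (simp add: character_group_def)
  show "(\<chi> [^]\<^bsub>character_group q\<^esub> d) n = \<chi> n ^ d"
    using assms(2)
  proof (induction d rule: dec_induct)
    case base
    show ?case using assms(1) by (simp add: carrier)
  next
    case (step k)
    thus ?case by (simp add: mult)
  qed
qed

lemma norm_inverse_powr:
  assumes "p > 0"
  shows "norm (1 / of_nat p powr s :: complex) = real p powr (- Re s)"
  using assms by (simp add: norm_divide norm_powr_real_powr powr_minus_divide)

lemma powr_minus_le_half:
  assumes "p \<ge> 2" "\<sigma> \<ge> 1"
  shows "real p powr (- \<sigma>) \<le> 1 / real p" "real p powr (- \<sigma>) \<le> 1 / 2"
proof -
  have "real p powr (- \<sigma>) \<le> real p powr (- 1)" using assms by (intro powr_mono) auto
  also have "\<dots> = 1 / real p" using assms by (simp add: powr_minus_divide)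
  finally show "real p powr (- \<sigma>) \<le> 1 / real p" .
  also have "1 / real p \<le> 1 / 2" using assms by simp
  finally show "real p powr (- \<sigma>) \<le> 1 / 2" .
qed

lemma of_nat_powr_of_nat_mult:
  assumes "p > 0"
  shows "(of_nat p :: complex) powr (of_nat n * s) = (of_nat p powr s) ^ n"
  using assms by (simp add: powr_def exp_of_nat_mult[symmetric] mult_ac)

lemma norm_euler_factor_le:
  assumes "\<chi> \<in> dirichlet_characters q" "q \<ge> 1" "p > 0"
  shows "norm (\<chi> (int p) / of_nat p powr w) \<le> real p powr (- Re w)"
proof -
  have "norm (\<chi> (int p) / of_nat p powr w) = norm (\<chi> (int p)) * real p powr (- Re w)"
    unfolding norm_inverse_powr[OF assms(3), symmetric] by (simp add: norm_divide)
  also have "\<dots> \<le> 1 * real p powr (- Re w)"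
    by (intro mult_right_mono norm_character_le_1[OF assms(1,2)]) auto
  finally show ?thesis by simp
qed

lemma log_euler_factor_has_sum:
  assumes "\<chi> \<in> dirichlet_characters q" "q \<ge> 1" "Re w > 1" "p \<ge> 2"
  shows "((\<lambda>k. \<chi> (int p) ^ k / (of_nat k * of_nat p powr (of_nat k * w)))
           has_sum - Ln (1 - \<chi> (int p) / of_nat p powr w)) {1..}"
proof -
  have "norm (\<chi> (int p) / of_nat p powr w) \<le> 1 / 2"
    using norm_euler_factor_le[OF assms(1,2), of p w] powr_minus_le_half(2)[of p "Re w"] assms
    by linarith
  hence "norm (\<chi> (int p) / of_nat p powr w) < 1" by simp
  from has_sum_log_series[OF this] show ?thesis
    using assms(4)
    by (subst of_nat_powr_of_nat_mult) (auto simp: power_divide mult.commute)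
qed

lemma log_L_from_has_sum:
  assumes "\<chi> \<in> dirichlet_characters q" "q \<ge> 1" "Re w > 1"
  shows "((\<lambda>p. \<Sum>\<^sub>\<infinity>k\<in>{1::nat..}. \<chi> (int p) ^ k / (of_nat k * of_nat p powr (of_nat k * w)))
           has_sum log_L_from P w \<chi>) {p. prime p \<and> p \<ge> P}"
  unfolding log_L_from_def
proof (rule has_sum_infsum, rule abs_summable_summable,
    rule Infinite_Sum.abs_summable_on_comparison_test')
  have "summable (\<lambda>p. norm (2 * real p powr (- Re w)))"
    using assms(3) by (simp add: summable_real_powr_iff)
  from norm_summable_imp_summable_on[OF this]
  show "(\<lambda>p. 2 * real p powr (- Re w)) summable_on {p. prime p \<and> p \<ge> P}"
    by (rule summable_on_subset_banach) auto
  fix p assume "p \<in> {p. prime p \<and> p \<ge> P}"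
  hence p: "p \<ge> 2" using prime_ge_2_nat by blast
  define y where "y = \<chi> (int p) / of_nat p powr w"
  have y: "norm y \<le> real p powr (- Re w)"
    unfolding y_def using p by (intro norm_euler_factor_le[OF assms(1,2)]) auto
  moreover have "real p powr (- Re w) < 1 / 2"
  proof -
    have "real p powr (- Re w) \<le> 2 powr (- Re w)" using p assms(3) by (intro powr_mono2') auto
    also have "\<dots> < 2 powr (- 1)" using assms(3) by (intro powr_less_mono) auto
    finally show ?thesis by (simp add: powr_minus_divide)
  qed
  ultimately have "norm (Ln (1 + (- y))) \<le> 2 * norm (- y)" by (intro norm_Ln_le) auto
  moreover have "(\<Sum>\<^sub>\<infinity>k\<in>{1::nat..}. \<chi> (int p) ^ k / (of_nat k * of_nat p powr (of_nat k * w)))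
      = - Ln (1 - y)"
    unfolding y_def by (rule infsumI[OF log_euler_factor_has_sum[OF assms p]])
  ultimately show "norm (\<Sum>\<^sub>\<infinity>k\<in>{1::nat..}. \<chi> (int p) ^ k / (of_nat k * of_nat p powr (of_nat k * w)))
      \<le> 2 * real p powr (- Re w)"
    using y by simp
qed

lemma Re_of_nat_mult_gt_1:
  assumes "Re s > 1" "l \<ge> 1"
  shows "Re (of_nat l * s) > 1"
proof -
  have "1 < 1 * Re s" using assms(1) by simp
  also have "\<dots> \<le> real l * Re s" using assms by (intro mult_right_mono) auto
  finally show ?thesis by simp
qed

text \<open>
  By complete multiplicativity \<open>\<chi> p ^ (d * k)\<close> is \<open>\<chi>\<close> at the integer \<open>p ^ (d * k)\<close>, so orthogonality turns
  the average over the characters into the indicator of \<open>p ^ (d * k) \<equiv> a\<close>.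
\<close>

lemma moebius_log_term_character_expansion:
  assumes "q \<ge> 1" "coprime a (int q)" "Re s > 1" "p \<ge> 2" "l \<ge> 1"
  defines "b \<equiv> \<lambda>n. if [int p ^ n = a] (mod int q) then 1 else 0"
  shows "(\<Sum>\<^sub>\<infinity>k\<in>{1..}. moebius_log_term b (1 / of_nat p powr s) l k) =
     1 / of_nat l * (\<Sum>d | d dvd l. of_int (moebius_mu d) *
       (\<Sum>\<chi>\<in>dirichlet_characters q. cnj (\<chi> a) / of_nat (totient q) *
         (\<Sum>\<^sub>\<infinity>k\<in>{1::nat..}. (\<chi> [^]\<^bsub>character_group q\<^esub> d) (int p) ^ k /
            (of_nat k * of_nat p powr (of_nat k * (of_nat l * s))))))"
proof (rule infsumI)
  define F where "F d \<chi> k = (\<chi> [^]\<^bsub>character_group q\<^esub> d) (int p) ^ k /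
            (of_nat k * of_nat p powr (of_nat k * (of_nat l * s)))"
    for d :: nat and \<chi> and k :: nat
  have ls: "Re (of_nat l * s) > 1" using assms by (intro Re_of_nat_mult_gt_1)
  have d1: "d \<ge> 1" if "d dvd l" for d using that assms(5) by (auto simp: Suc_le_eq intro: dvd_pos_nat)
  have "((\<lambda>k. 1 / of_nat l * (\<Sum>d | d dvd l. of_int (moebius_mu d) *
       (\<Sum>\<chi>\<in>dirichlet_characters q. cnj (\<chi> a) / of_nat (totient q) * F d \<chi> k)))
     has_sum 1 / of_nat l * (\<Sum>d | d dvd l. of_int (moebius_mu d) *
       (\<Sum>\<chi>\<in>dirichlet_characters q. cnj (\<chi> a) / of_nat (totient q) *
         (\<Sum>\<^sub>\<infinity>k\<in>{1..}. F d \<chi> k)))) {1..}"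
  proof (intro has_sum_cmult_right has_sum_sum)
    fix d \<chi> assume "d \<in> {d. d dvd l}" "\<chi> \<in> dirichlet_characters q"
    hence "\<chi> [^]\<^bsub>character_group q\<^esub> d \<in> dirichlet_characters q"
      using d1 by (intro character_group_pow) auto
    from log_euler_factor_has_sum[OF this assms(1) ls assms(4)]
    show "(F d \<chi> has_sum (\<Sum>\<^sub>\<infinity>k\<in>{1..}. F d \<chi> k)) {1..}"
      unfolding F_def by (intro has_sum_infsum has_sum_imp_summable)
  qed
  moreover have "1 / of_nat l * (\<Sum>d | d dvd l. of_int (moebius_mu d) *
       (\<Sum>\<chi>\<in>dirichlet_characters q. cnj (\<chi> a) / of_nat (totient q) * F d \<chi> k))
      = moebius_log_term b (1 / of_nat p powr s) l k" for k
  proof -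
    have "(\<Sum>\<chi>\<in>dirichlet_characters q. cnj (\<chi> a) / of_nat (totient q) * F d \<chi> k)
        = b (d * k) * ((1 / of_nat p powr s) ^ (l * k) / of_nat k)" if "d dvd l" for d
    proof -
      have "F d \<chi> k = \<chi> (int p ^ (d * k)) * ((1 / of_nat p powr s) ^ (l * k) / of_nat k)"
        if "\<chi> \<in> dirichlet_characters q" for \<chi>
      proof -
        have "(of_nat p :: complex) powr (of_nat k * (of_nat l * s)) = (of_nat p powr s) ^ (l * k)"
          using of_nat_powr_of_nat_mult[of p "k * l" s] assms(4) by (simp add: mult_ac)
        thus ?thesis
          unfolding F_def character_group_pow(2)[OF that d1[OF \<open>d dvd l\<close>]] character_power[OF that]
          by (simp add: power_mult power_divide)
      qed
      hence "(\<Sum>\<chi>\<in>dirichlet_characters q. cnj (\<chi> a) / of_nat (totient q) * F d \<chi> k)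
          = (\<Sum>\<chi>\<in>dirichlet_characters q. (cnj (\<chi> a) * \<chi> (int p ^ (d * k))) *
              ((1 / of_nat p powr s) ^ (l * k) / of_nat k / of_nat (totient q)))"
        by (intro sum.cong) (auto simp: mult_ac)
      also have "\<dots> = (if [int p ^ (d * k) = a] (mod int q) then of_nat (totient q) else 0) *
              ((1 / of_nat p powr s) ^ (l * k) / of_nat k / of_nat (totient q))"
        by (simp only: sum_distrib_right[symmetric] character_orthogonality[OF assms(1,2)])
      also have "\<dots> = b (d * k) * ((1 / of_nat p powr s) ^ (l * k) / of_nat k)"
        using assms(1) by (simp add: b_def)
      finally show ?thesis .
    qed
    hence "1 / of_nat l * (\<Sum>d | d dvd l. of_int (moebius_mu d) *
       (\<Sum>\<chi>\<in>dirichlet_characters q. cnj (\<chi> a) / of_nat (totient q) * F d \<chi> k))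
     = 1 / of_nat l * (\<Sum>d | d dvd l. of_int (moebius_mu d) *
        (b (d * k) * ((1 / of_nat p powr s) ^ (l * k) / of_nat k)))"
      by simp
    also have "\<dots> = moebius_log_term b (1 / of_nat p powr s) l k"
      unfolding moebius_log_term_def by (simp add: sum_distrib_left sum_distrib_right sum_divide_distrib mult_ac)
    finally show ?thesis .
  qed
  ultimately show "(moebius_log_term b (1 / of_nat p powr s) l has_sum
    1 / of_nat l * (\<Sum>d | d dvd l. of_int (moebius_mu d) *
       (\<Sum>\<chi>\<in>dirichlet_characters q. cnj (\<chi> a) / of_nat (totient q) *
         (\<Sum>\<^sub>\<infinity>k\<in>{1..}. (\<chi> [^]\<^bsub>character_group q\<^esub> d) (int p) ^ k /
            (of_nat k * of_nat p powr (of_nat k * (of_nat l * s))))))) {1..}"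
    by (simp add: F_def)
qed

lemma Y_P_has_sum:
  assumes "q \<ge> 1" "coprime a (int q)" "Re s > 1"
  shows "((\<lambda>p. \<Sum>l = 1..L. \<Sum>\<^sub>\<infinity>k\<in>{1..}.
      moebius_log_term (\<lambda>n. if [int p ^ n = a] (mod int q) then 1 else 0) (1 / of_nat p powr s) l k)
    has_sum - Y_P P s q a L) {p. prime p \<and> p \<ge> P}"
proof -
  define F where "F d l \<chi> p = (\<Sum>\<^sub>\<infinity>k\<in>{1::nat..}. (\<chi> [^]\<^bsub>character_group q\<^esub> d) (int p) ^ k /
            (of_nat k * of_nat p powr (of_nat k * (of_nat l * s))))" for d l :: nat and \<chi> and p :: nat
  have "((\<lambda>p. \<Sum>l = 1..L. 1 / of_nat l * (\<Sum>d | d dvd l. of_int (moebius_mu d) *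
       (\<Sum>\<chi>\<in>dirichlet_characters q. cnj (\<chi> a) / of_nat (totient q) * F d l \<chi> p)))
     has_sum (\<Sum>l = 1..L. 1 / of_nat l * (\<Sum>d | d dvd l. of_int (moebius_mu d) *
       (\<Sum>\<chi>\<in>dirichlet_characters q. cnj (\<chi> a) / of_nat (totient q) *
         log_L_from P (of_nat l * s) (\<chi> [^]\<^bsub>character_group q\<^esub> d))))) {p. prime p \<and> p \<ge> P}"
  proof (intro has_sum_cmult_right has_sum_sum)
    fix l d \<chi> assume *: "l \<in> {1..L}" "d \<in> {d. d dvd l}" "\<chi> \<in> dirichlet_characters q"
    have "Re (of_nat l * s) > 1" using assms * by (intro Re_of_nat_mult_gt_1) auto
    moreover have "d \<ge> 1" using * by (auto simp: Suc_le_eq intro: dvd_pos_nat)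
    hence "\<chi> [^]\<^bsub>character_group q\<^esub> d \<in> dirichlet_characters q"
      using * by (intro character_group_pow) auto
    ultimately show "(F d l \<chi> has_sum log_L_from P (of_nat l * s) (\<chi> [^]\<^bsub>character_group q\<^esub> d))
        {p. prime p \<and> p \<ge> P}"
      unfolding F_def using assms(1) by (intro log_L_from_has_sum)
  qed
  also have "(\<Sum>l = 1..L. 1 / of_nat l * (\<Sum>d | d dvd l. of_int (moebius_mu d) *
       (\<Sum>\<chi>\<in>dirichlet_characters q. cnj (\<chi> a) / of_nat (totient q) *
         log_L_from P (of_nat l * s) (\<chi> [^]\<^bsub>character_group q\<^esub> d)))) = - Y_P P s q a L"
    by (simp add: Y_P_def character_group_def)
  finally show ?thesis
  proof (rule has_sum_cong[THEN iffD1, rotated])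
    fix p assume "p \<in> {p. prime p \<and> p \<ge> P}"
    hence p: "p \<ge> 2" using prime_ge_2_nat by blast
    show "(\<Sum>l = 1..L. 1 / of_nat l * (\<Sum>d | d dvd l. of_int (moebius_mu d) *
       (\<Sum>\<chi>\<in>dirichlet_characters q. cnj (\<chi> a) / of_nat (totient q) * F d l \<chi> p))) =
     (\<Sum>l = 1..L. \<Sum>\<^sub>\<infinity>k\<in>{1..}.
      moebius_log_term (\<lambda>n. if [int p ^ n = a] (mod int q) then 1 else 0) (1 / of_nat p powr s) l k)"
      unfolding F_def
      by (intro sum.cong refl moebius_log_term_character_expansion[symmetric] assms p) auto
  qed
qed

text \<open>
  Factor off \<open>r ^ L\<close>, which is \<open>P powr (- L \<sigma>)\<close> times a power of \<open>P / p \<le> 1\<close> with exponent at least \<open>2\<close>. What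
  remains is at most \<open>1 / (p\<^sup>2 (p - 1)) \<le> (3 / 2) / ((p - 1) p (p + 1))\<close>, a difference of consecutive values
  of \<open>h\<close>. The factor \<open>3 / 2\<close> is the smallest that works at \<open>p = 2\<close>.
\<close>

lemma truncation_error_le_telescoping:
  assumes "P \<ge> 2" "p \<ge> P" "L \<ge> 2" "\<sigma> \<ge> 1"
  defines "r \<equiv> real p powr (- \<sigma>)"
  defines "h \<equiv> \<lambda>n. 3 / 4 / (real n * (real n - 1))"
  shows "r ^ (L + 1) / (1 - r) \<le> real P powr (- (real L * \<sigma>)) * (real P)\<^sup>2 * (h p - h (Suc p))"
proof -
  have p: "p \<ge> 2" using assms by simp
  have r0: "r \<ge> 0" by (simp add: r_def)
  have r1: "r \<le> 1 / real p" "r \<le> 1 / 2" using powr_minus_le_half p assms(4) by (auto simp: r_def)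
  have "real p * r \<le> 1" using r1(1) p by (simp add: field_simps)
  hence tail: "r / (1 - r) \<le> 1 / (real p - 1)"
    using r1 p by (simp add: divide_simps) (simp add: algebra_simps)
  have "2 * 1 \<le> real L * \<sigma>" using assms(3,4) by (intro mult_mono) auto
  hence e: "2 \<le> real L * \<sigma>" by simp
  have "r ^ L = real p powr (- (real L * \<sigma>))"
    using p by (simp add: r_def powr_powr mult_ac flip: powr_realpow)
  also have "\<dots> = real P powr (- (real L * \<sigma>)) * (real P / real p) powr (real L * \<sigma>)"
    using assms(1) p by (simp add: powr_divide powr_minus field_simps)
  also have "(real P / real p) powr (real L * \<sigma>) \<le> (real P / real p) powr 2"
    using assms(1,2) e by (intro powr_mono') auto
  also have "(real P / real p) powr 2 = (real P)\<^sup>2 / (real p)\<^sup>2"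
    using assms(1) p by (simp add: powr_numeral power_divide)
  finally have main: "r ^ L \<le> real P powr (- (real L * \<sigma>)) * ((real P)\<^sup>2 / (real p)\<^sup>2)"
    by (simp add: mult_left_mono)
  have "r ^ (L + 1) / (1 - r) = r ^ L * (r / (1 - r))" by simp
  also have "\<dots> \<le> (real P powr (- (real L * \<sigma>)) * ((real P)\<^sup>2 / (real p)\<^sup>2)) * (1 / (real p - 1))"
    using r0 r1 by (intro mult_mono main tail) auto
  also have "\<dots> = real P powr (- (real L * \<sigma>)) * (real P)\<^sup>2 * (1 / ((real p)\<^sup>2 * (real p - 1)))"
    by simp
  also have "1 / ((real p)\<^sup>2 * (real p - 1)) \<le> h p - h (Suc p)"
  proof -
    define y where "y = real p"
    have y: "y \<ge> 2" using p by (simp add: y_def)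
    have "h p - h (Suc p) = 3 / 4 / (y * (y - 1)) - 3 / 4 / ((y + 1) * y)"
      by (simp add: h_def y_def add_ac)
    also have "\<dots> = 3 / 2 / ((y - 1) * y * (y + 1))"
      using y by (simp add: divide_simps)
    also have "\<dots> \<ge> 1 / (y\<^sup>2 * (y - 1))"
    proof -
      have "3 / 2 / ((y - 1) * y * (y + 1)) - 1 / (y\<^sup>2 * (y - 1))
          = (y / 2 - 1) / (y\<^sup>2 * (y - 1) * (y + 1))"
        using y by (simp add: divide_simps power2_eq_square)
      also have "\<dots> \<ge> 0" using y by (intro divide_nonneg_nonneg mult_nonneg_nonneg) auto
      finally show ?thesis by simp
    qed
    finally show ?thesis by (simp add: y_def)
  qed
  finally show ?thesis by (simp add: mult_left_mono)
qed

lemma telescoping_has_sum: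
  assumes "P \<ge> 2"
  defines "h \<equiv> \<lambda>n. 3 / 4 / (real n * (real n - 1))"
  shows "((\<lambda>n. h n - h (Suc n)) has_sum h P) {P..}"
proof -
  have "(\<lambda>n. h (n + P)) \<longlonglongrightarrow> 0" unfolding h_def by real_asymp
  hence "(\<lambda>n. h (n + P) - h (Suc n + P)) sums (h (0 + P) - 0)" by (rule telescope_sums')
  moreover have "h (n + P) - h (Suc n + P) \<ge> 0" for n
    using assms(1) unfolding h_def
    by (auto intro!: divide_left_mono mult_mono mult_pos_pos)
  ultimately have "((\<lambda>n. h (n + P) - h (Suc n + P)) has_sum h P) UNIV"
    using sums_nonneg_imp_has_sum[of "\<lambda>n. h (n + P) - h (Suc n + P)"] by simp
  also have "?this \<longleftrightarrow> ?thesis"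
    by (rule has_sum_reindex_bij_witness[where i = "\<lambda>n. n - P" and j = "\<lambda>n. n + P"]) auto
  finally show ?thesis .
qed

theorem corollary3:
  fixes q P L :: nat and a :: int and s :: complex
  assumes "q \<ge> 1" and "coprime a (int q)" and "P \<ge> 2" and "L \<ge> 2" and "Re s > 1"
  shows "\<exists>E::complex. norm E \<le> real P powr (- (real L * Re s)) \<and>
    (\<lambda>p. if prime p \<and> p \<ge> P \<and> [int p = a] (mod int q) then 1 - 1 / of_nat p powr s else 1)
      has_prod exp (Y_P P s q a L + E)"
proof -
  define A where "A = {p. prime p \<and> p \<ge> P}"
  define x where "x p = (1 / of_nat p powr s :: complex)" for p :: nat
  define b where "b p n = (if [int p ^ n = a] (mod int q) then 1 else 0 :: complex)" for p n :: nat
  define T where "T p = (\<Sum>l = 1..L. \<Sum>\<^sub>\<infinity>k\<in>{1..}. moebius_log_term (b p) (x p) l k)" for p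
  define e where "e p = T p + b p 1 * Ln (1 - x p)" for p
  define h where "h n = 3 / 4 / (real n * (real n - 1))" for n
  define M where "M = 4 / 7 * (real P powr (- (real L * Re s)) * (real P)\<^sup>2)"
  have p2: "p \<ge> 2" if "p \<in> A" for p using that prime_ge_2_nat by (auto simp: A_def)
  have norm_x: "norm (x p) = real p powr (- Re s)" if "p \<in> A" for p
    unfolding x_def using p2[OF that] by (intro norm_inverse_powr) auto
  have half: "norm (x p) \<le> 1 / 2" if "p \<in> A" for p
    unfolding norm_x[OF that] using p2[OF that] assms(5) by (intro powr_minus_le_half) auto
  have T: "(T has_sum - Y_P P s q a L) A"
    unfolding T_def x_def b_def A_def using assms by (intro Y_P_has_sum)
  have h: "((\<lambda>p. M * (h p - h (Suc p))) has_sum M * h P) {P..}"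
    unfolding h_def using assms(3) by (intro has_sum_cmult_right telescoping_has_sum)
  have AP: "A \<subseteq> {P..}" by (auto simp: A_def)
  have hA: "((\<lambda>p. M * (h p - h (Suc p))) has_sum (\<Sum>\<^sub>\<infinity>p\<in>A. M * (h p - h (Suc p)))) A"
    using summable_on_subset_banach[OF has_sum_imp_summable[OF h] AP] by (rule has_sum_infsum)
  have e_le: "norm (e p) \<le> M * (h p - h (Suc p))" if p: "p \<in> A" for p
  proof -
    have "norm (e p) \<le> 4 / 7 * (norm (x p) ^ (L + 1) / (1 - norm (x p)))"
      unfolding e_def T_def by (rule truncated_moebius_log_series) (use half p assms(4) in \<open>auto simp: b_def\<close>)
    also have "norm (x p) ^ (L + 1) / (1 - norm (x p))
        \<le> real P powr (- (real L * Re s)) * (real P)\<^sup>2 * (h p - h (Suc p))"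
      unfolding norm_x[OF p] h_def
      by (rule truncation_error_le_telescoping) (use p assms in \<open>auto simp: A_def\<close>)
    finally show ?thesis by (simp add: M_def)
  qed
  define E where "E = infsum e A"
  have "e summable_on A"
    by (rule abs_summable_summable, rule Infinite_Sum.abs_summable_on_comparison_test',
        rule has_sum_imp_summable[OF hA], rule e_le)
  hence E: "(e has_sum E) A" unfolding E_def by (rule has_sum_infsum)
  have "norm E \<le> (\<Sum>\<^sub>\<infinity>p\<in>A. M * (h p - h (Suc p)))"
    by (rule norm_infsum_le[OF E hA e_le])
  \<comment> \<open>the primes are replaced by all integers from \<open>P\<close> on, where the bound telescopes\<close>
  also have "\<dots> \<le> M * h P"
  proof (rule has_sum_mono2[OF hA h AP])
    fix p assume "p \<in> {P..} - A"
    hence "h (Suc p) \<le> h p" using assms(3)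
      unfolding h_def by (auto intro!: divide_left_mono mult_mono mult_pos_pos)
    thus "M * (h p - h (Suc p)) \<ge> 0" by (simp add: M_def)
  qed
  also have "\<dots> = real P powr (- (real L * Re s)) * (3 / 7 * (real P / (real P - 1)))"
  proof -
    have *: "4 / 7 * (c * y\<^sup>2) * (3 / 4 / (y * (y - 1))) = c * (3 / 7 * (y / (y - 1)))"
      if "y \<ge> 2" for c y :: real
      using that by (simp add: divide_simps power2_eq_square)
    show ?thesis unfolding M_def h_def by (rule *) (use assms(3) in simp)
  qed
  \<comment> \<open>\<open>P / (P - 1) \<le> 2\<close>, so the constant is at most \<open>6 / 7\<close>\<close>
  also have "\<dots> \<le> real P powr (- (real L * Re s)) * 1"
    using assms(3) by (intro mult_left_mono) (auto simp: field_simps)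
  finally have norm_E: "norm E \<le> real P powr (- (real L * Re s))" by simp

  define g where "g p = (if p \<in> A then b p 1 * Ln (1 - x p) else 0)" for p
  have "((\<lambda>p. e p - T p) has_sum (E - - Y_P P s q a L)) A"
    using has_sum_add[OF E has_sum_uminusI[OF T]] by simp
  also have "?this \<longleftrightarrow> (g has_sum (E - - Y_P P s q a L)) UNIV"
    by (rule has_sum_cong_neutral) (auto simp: g_def e_def)
  finally have "g sums (Y_P P s q a L + E)"
    by (simp add: has_sum_imp_sums add.commute)
  hence "(\<lambda>p. exp (g p)) has_prod exp (Y_P P s q a L + E)"
    using sums_imp_has_prod_exp[of g] by (simp add: has_prod_def)
  moreover have "exp (g p) =
    (if prime p \<and> p \<ge> P \<and> [int p = a] (mod int q) then 1 - 1 / of_nat p powr s else 1)" for p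
  proof (cases "p \<in> A")
    case True
    hence "1 - x p \<noteq> 0" using half[of p] by auto
    thus ?thesis using True by (simp add: g_def A_def b_def x_def)
  qed (auto simp: g_def A_def)
  ultimately show ?thesis using norm_E by (intro exI[of _ E]) simp
qed

end
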